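(* There exists a probability measure $\mu$ on $\mathbb C_0$ such that: (a) for all $0<p,l<\infty$, both area operators $\mathbb A_{\mu,l}:\mathscr H^p\to L_{\mathrm i}^p$ and $\mathbb A_{\mu,l}:\mathscr H^p_0\to L_{\mathrm i}^p$ are bounded; and (b) $\mu$ is neither a Carleson measure on $\mathbb C_0$ nor a Carleson measure on $\mathbb C_{1/2}$, and, for every $0<p<\infty$, $\mu$ is neither an $H^p_{\mathrm i}(\mathbb C_0)$-Carleson measure nor an $H^p_{\mathrm i}(\mathbb C_{1/2})$-Carleson measure.
   Context: Half-planes: $\mathbb C_\theta=\{s\in\mathbb C:\operatorname{Re}s>\theta\}$, and we write $s=\sigma+it$. Hardy spaces of Dirichlet series: $\mathbb T^\infty$ is the countably infinite torus with normalized Haar measure $m_\infty$. Each $\chi=(\chi_1,\chi_2,\dots)\in\mathbb T^\infty$ is identified with the completely multiplicative function $\chi:\mathbb N\to\mathbb T$ with $\chi(\mathfrak p_j)=\chi_j$, where $\mathfrak p_j$ is the $j$-th prime. For $0<p<\infty$, $\mathscr H^p$ is the completion of the Dirichlet polynomials $P(s)=\sum_{n\le N}a_nn^{-s}$ in the (quasi-)norm $\|P\|_{\mathscr H^p}=\big(\int_{\mathbb T^\infty}|\sum_{n\le N}a_n\chi(n)|^p\,dm_\infty(\chi)\big)^{1/p}$; its elements are identified with Dirichlet series $f(s)=\sum_{n\ge1}a_nn^{-s}$. $\mathscr H^p_0$ is the closed subspace of those $f$ with $f(+\infty):=a_1=0$. The vertical limit of $f$ is $f_\chi(s)=\sum_{n\ge1}a_n\chi(n)n^{-s}$;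 for $f\in\mathscr H^p$ it is known that for $m_\infty$-almost every $\chi$ it extends analytically to $\mathbb C_0$, and $f_\chi$ denotes this extension. Area operator: for $\tau\in\mathbb R$, $\Gamma_\tau=\{\sigma+it\in\mathbb C_0:|t-\tau|<\sigma\}$. For $0<l<\infty$ and a positive Borel measure $\mu$ on $\mathbb C_0$, $$\mathbb A_{\mu,l}f(\chi,\tau)=\Big(\int_{\Gamma_\tau}|f_\chi(s)|^l\frac{d\mu(s)}{\operatorname{Re}s}\Big)^{1/l},\quad \chi\in\mathbb T^\infty,\ \tau\in\mathbb R,$$ with value $+\infty$ allowed. $L^p_{\mathrm i}$ is the space of measurable $F$ on $\mathbb T^\infty\times\mathbb R$ with $\|F\|_{L^p_{\mathrm i}}^p=\int_{\mathbb T^\infty}\int_{\mathbb R}|F(\chi,\tau)|^p\frac{d\tau}{1+\tau^2}\,dm_\infty(\chi)<\infty$. For $X=\mathscr H^p$ or $\mathscr H^p_0$, $\mathbb A_{\mu,l}:X\to L^p_{\mathrm i}$ is bounded if there is $C<\infty$ with $\|\mathbb A_{\mu,l}f\|_{L^p_{\mathrm i}}\le C\|f\|_{\mathscr H^p}$ for all $f\in X$. Carleson conditions: for $\theta\in\mathbb R$ and a finite interval $I\subset\mathbb R$ of length $|I|>0$, $Q_\theta(I)=\{\sigma+it:\theta<\sigma\le\theta+|I|,\ t\in I\}$. A positive Borel measure $\mu$ is a Carleson measure on $\mathbb C_\theta$ if $\sup_{0<|I|<\infty}\mu(Q_\theta(I))/|I|<\infty$. The space $H^p_{\mathrm i}(\mathbb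 C_\theta)$ consists of analytic $f$ on $\mathbb C_\theta$ with $\|f\|^p_{H^p_{\mathrm i}(\mathbb C_\theta)}=\sup_{\sigma>\theta}\frac1\pi\int_{\mathbb R}|f(\sigma+it)|^p\frac{dt}{1+t^2}<\infty$, and $\mu$ is an $H^p_{\mathrm i}(\mathbb C_\theta)$-Carleson measure if the embedding $H^p_{\mathrm i}(\mathbb C_\theta)\to L^p(\mathbb C_\theta,\mu)$ is bounded. For $\theta=1/2$ these conditions are applied to the restriction of $\mu$ to $\mathbb C_{1/2}$. *)

theory Defs
  imports
    "HOL-Probability.Probability"
    "HOL-Complex_Analysis.Complex_Analysis"
    "HOL-Library.Infinite_Set"
    "HOL-Computational_Algebra.Primes"
begin

definition halfplane :: "real \<Rightarrow> complex set" where
  "halfplane \<theta> = {s. \<theta> < Re s}"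

text \<open>Powers with a positive real exponent on \<open>[0, \<infinity>]\<close>, with \<open>\<infinity>\<close> raised to such a power being \<open>\<infinity>\<close>.\<close>

definition ennreal_powr :: "ennreal \<Rightarrow> real \<Rightarrow> ennreal" where
  "ennreal_powr x a = (if x = \<top> then \<top> else ennreal (enn2real x powr a))"

definition Lp_norm :: "'a measure \<Rightarrow> real \<Rightarrow> ('a \<Rightarrow> ennreal) \<Rightarrow> ennreal" where
  "Lp_norm M p F = ennreal_powr (\<integral>\<^sup>+ x. ennreal_powr (F x) p \<partial>M) (1 / p)"

section \<open>The infinite torus and Hardy spaces of Dirichlet series\<close>

definition circle_haar :: "complex measure" where
  "circle_haar = distr (uniform_measure lborel {0..2 * pi}) (restrict_space borel (sphere 0 1)) cis"

text \<open>Coordinates are indexed from \<open>0\<close>, so \<open>chi j\<close> belongs to the prime \<open>nth_prime j\<close> and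
  \<open>nth_prime 0 = 2\<close>.\<close>

definition torus_haar :: "(nat \<Rightarrow> complex) measure" where
  "torus_haar = (\<Pi>\<^sub>M j\<in>(UNIV :: nat set). circle_haar)"

definition nth_prime :: "nat \<Rightarrow> nat" where
  "nth_prime j = enumerate {p. prime p} j"

text \<open>The completely multiplicative extension of \<open>chi\<close>; only values at \<open>n \<ge> 1\<close> are meaningful.\<close>

definition mult_char :: "(nat \<Rightarrow> complex) \<Rightarrow> nat \<Rightarrow> complex" where
  "mult_char chi n = (\<Prod>j | nth_prime j dvd n. chi j ^ multiplicity (nth_prime j) n)"

text \<open>A Dirichlet series is represented by its coefficient sequence, with the unused coefficient
  at index \<open>0\<close> set to \<open>0\<close>.\<close>

definition dirichlet_polys :: "(nat \<Rightarrow> complex) set" where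
  "dirichlet_polys = {a. a 0 = 0 \<and> finite {n. a n \<noteq> 0}}"

definition poly_norm :: "real \<Rightarrow> (nat \<Rightarrow> complex) \<Rightarrow> real" where
  "poly_norm p a =
     (LINT chi|torus_haar. cmod (\<Sum>n | a n \<noteq> 0. a n * mult_char chi n) powr p) powr (1 / p)"

text \<open>An element of the completion is represented by a Cauchy sequence of Dirichlet polynomials.
  Its Dirichlet series has as coefficients the limits of the coefficients of the polynomials.\<close>

definition Hp_approx :: "real \<Rightarrow> (nat \<Rightarrow> complex) \<Rightarrow> (nat \<Rightarrow> nat \<Rightarrow> complex) \<Rightarrow> bool" where
  "Hp_approx p a P \<longleftrightarrow>
     (\<forall>k. P k \<in> dirichlet_polys) \<and>
     (\<forall>\<epsilon>>0. \<exists>K. \<forall>j\<ge>K. \<forall>k\<ge>K. poly_norm p (\<lambda>n. P j n - P k n) < \<epsilon>) \<and>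
     (\<forall>n. (\<lambda>k. P k n) \<longlonglongrightarrow> a n)"

definition Hp :: "real \<Rightarrow> (nat \<Rightarrow> complex) set" where
  "Hp p = {a. \<exists>P. Hp_approx p a P}"

definition Hp0 :: "real \<Rightarrow> (nat \<Rightarrow> complex) set" where
  "Hp0 p = {a \<in> Hp p. a 1 = 0}"

text \<open>The norm of the completion is the limit of the norms of the approximating polynomials.
  An element of the completion is determined by its Dirichlet series, so for \<open>a \<in> Hp p\<close> the set
  below has exactly one element, and \<open>Inf\<close> selects it.\<close>

definition Hp_norm :: "real \<Rightarrow> (nat \<Rightarrow> complex) \<Rightarrow> real" where
  "Hp_norm p a = Inf {N. \<exists>P. Hp_approx p a P \<and> (\<lambda>k. poly_norm p (P k)) \<longlonglongrightarrow> N}"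

definition extends_vertical_limit ::
    "(nat \<Rightarrow> complex) \<Rightarrow> (nat \<Rightarrow> complex) \<Rightarrow> (complex \<Rightarrow> complex) \<Rightarrow> bool" where
  "extends_vertical_limit a chi g \<longleftrightarrow>
     g holomorphic_on halfplane 0 \<and>
     (\<exists>\<theta>\<ge>0. \<forall>s\<in>halfplane \<theta>. (\<lambda>n. a n * mult_char chi n * of_nat n powr (- s)) sums g s)"

text \<open>By the identity theorem the extension is unique on \<open>halfplane 0\<close>, the only place where it is
  used. For \<open>a \<in> Hp p\<close> it exists for almost every \<open>chi\<close>; elsewhere the value is \<open>0\<close> by convention.\<close>

definition vertical_limit ::
    "(nat \<Rightarrow> complex) \<Rightarrow> (nat \<Rightarrow> complex) \<Rightarrow> complex \<Rightarrow> complex" where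
  "vertical_limit a chi =
     (if \<exists>g. extends_vertical_limit a chi g then SOME g. extends_vertical_limit a chi g else (\<lambda>_. 0))"

section \<open>The area operator\<close>

definition nt_cone :: "real \<Rightarrow> complex set" where
  "nt_cone \<tau> = {s \<in> halfplane 0. \<bar>Im s - \<tau>\<bar> < Re s}"

definition area_op ::
    "complex measure \<Rightarrow> real \<Rightarrow> (nat \<Rightarrow> complex) \<Rightarrow> (nat \<Rightarrow> complex) \<times> real \<Rightarrow> ennreal" where
  "area_op \<mu> l a = (\<lambda>(chi, \<tau>).
     ennreal_powr
       (\<integral>\<^sup>+ s\<in>nt_cone \<tau>. ennreal (cmod (vertical_limit a chi s) powr l / Re s) \<partial>\<mu>) (1 / l))"

text \<open>The completion is taken because \<open>vertical_limit\<close> is determined only almost everywhere in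
  \<open>chi\<close>, and measurability is meant up to null sets.\<close>

definition Li_measure :: "((nat \<Rightarrow> complex) \<times> real) measure" where
  "Li_measure =
     completion (torus_haar \<Otimes>\<^sub>M density lborel (\<lambda>\<tau>. ennreal (1 / (1 + \<tau>\<^sup>2))))"

definition area_op_bounded ::
    "complex measure \<Rightarrow> real \<Rightarrow> real \<Rightarrow> (nat \<Rightarrow> complex) set \<Rightarrow> bool" where
  "area_op_bounded \<mu> l p X \<longleftrightarrow>
     (\<forall>a\<in>X. area_op \<mu> l a \<in> borel_measurable Li_measure) \<and>
     (\<exists>C::real. C \<ge> 0 \<and> (\<forall>a\<in>X. Lp_norm Li_measure p (area_op \<mu> l a) \<le> ennreal (C * Hp_norm p a)))"

section \<open>Carleson conditions\<close>

definition carleson_square :: "real \<Rightarrow> real set \<Rightarrow> complex set" where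
  "carleson_square \<theta> I = {s. \<theta> < Re s \<and> Re s \<le> \<theta> + measure lborel I \<and> Im s \<in> I}"

definition carleson_measure :: "real \<Rightarrow> complex measure \<Rightarrow> bool" where
  "carleson_measure \<theta> \<mu> \<longleftrightarrow>
     (SUP I\<in>{I. is_interval I \<and> bounded I \<and> 0 < measure lborel I}.
        emeasure \<mu> (carleson_square \<theta> I) / ennreal (measure lborel I)) < \<top>"

definition Hpi_norm :: "real \<Rightarrow> real \<Rightarrow> (complex \<Rightarrow> complex) \<Rightarrow> ennreal" where
  "Hpi_norm \<theta> p f = ennreal_powr
     (SUP \<sigma>\<in>{\<theta><..}.
        ennreal (1 / pi) * (\<integral>\<^sup>+ t. ennreal (cmod (f (Complex \<sigma> t)) powr p / (1 + t\<^sup>2)) \<partial>lborel)) (1 / p)"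

definition Hpi :: "real \<Rightarrow> real \<Rightarrow> (complex \<Rightarrow> complex) set" where
  "Hpi \<theta> p = {f. f holomorphic_on halfplane \<theta> \<and> Hpi_norm \<theta> p f < \<top>}"

definition Hpi_carleson_measure :: "real \<Rightarrow> real \<Rightarrow> complex measure \<Rightarrow> bool" where
  "Hpi_carleson_measure \<theta> p \<mu> \<longleftrightarrow>
     (\<exists>C::real. C \<ge> 0 \<and>
       (\<forall>f\<in>Hpi \<theta> p. Lp_norm \<mu> p (\<lambda>s. ennreal (cmod (f s))) \<le> ennreal C * Hpi_norm \<theta> p f))"

end

theory Submission
  imports Defs "HOL-Computational_Algebra.Fundamental_Theorem_Algebra"
begin

text \<open>
  The weight \<open>d\<tau> / (1 + \<tau>\<^sup>2)\<close> makes cones over distant points cheap, while the law of \<open>f\<^sub>\<chi>(\<sigma> + it)\<close> on the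
  torus does not depend on \<open>t\<close>. A measure can therefore be as concentrated as one likes in the
  horizontal direction, provided that its pieces move up fast enough. Carleson squares do not see the
  height, and the weight in the norm of the spaces \<open>H\<^sub>i\<^sup>p\<close> only makes test functions that are located
  high up smaller, so that moving up does not restore any Carleson condition.

  Concretely, \<open>\<mu>\<close> has atoms \<open>s\<^sub>k\<close> of mass \<open>2\<^sup>-\<^sup>k\<^sup>-\<^sup>1\<close> at height \<open>4 (k + 1)!\<close>, with real part \<open>4\<^sup>-\<^sup>k\<close> for even \<open>k\<close> and
  \<open>1/2 + 4\<^sup>-\<^sup>k\<close> for odd \<open>k\<close>. The mass divided by the distance to the line
  \<open>Re s = 0\<close> for even \<open>k\<close>, or to \<open>Re s = 1/2\<close> for odd \<open>k\<close>, is \<open>2\<^sup>k / 2\<close>, which is unbounded. This refutes the Carleson conditions directly, and the embeddings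
  through the test functions \<open>(s - \<theta> + h - it)\<^sup>-\<^sup>M\<close> with \<open>M p \<ge> 2\<close>
  (\<open>heavy_atoms_not_carleson\<close>, \<open>heavy_atoms_not_Hpi_carleson\<close>).

  The sets of those \<open>\<tau>\<close> whose cone contains \<open>s\<^sub>k\<close> are disjoint intervals of weighted length at most
  \<open>3 / k!\<close>. Hence the \<open>p\<close>-th power of the norm of the area function is a sum over \<open>k\<close>, with terms at most
  \<open>(2\<^sup>k)\<^sup>p\<^sup>/\<^sup>l \<cdot> (3 / k!) \<cdot> E |f\<^sub>\<chi>(s\<^sub>k)|\<^sup>p\<close>. The numerical factors are summable for all \<open>p\<close> and \<open>l\<close>, because
  they are dominated by an exponential series, so that everything rests on the
  contraction \<open>E |f\<^sub>\<chi>(s)|\<^sup>p \<le> \<parallel>f\<parallel>\<^sup>p\<close> for \<open>Re s > 0\<close> (\<open>vertical_limit_mean\<close>).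

  For a Dirichlet polynomial, \<open>E |P\<^sub>\<chi>(s)|\<^sup>p\<close> depends only on \<open>Re s\<close>, by rotation invariance of the Haar
  measure. Mapping the disc onto the right half-plane with \<open>0\<close> going to \<open>\<sigma>\<close> and using that \<open>|G|\<^sup>p\<close> is
  subharmonic for holomorphic \<open>G\<close> and every \<open>p > 0\<close>, one bounds the mean at \<open>\<sigma>\<close> by means at points
  arbitrarily near to the imaginary axis, hence by the mean at \<open>0\<close>
  (\<open>torus_mean_damped_le\<close>). The same argument applies to every nonnegative completely additive weight in place
  of \<open>log n\<close>. With the weight that counts one prime, letting \<open>\<sigma> \<rightarrow> \<infinity>\<close> isolates the terms of lowest order
  in this prime, and peeling off orders and primes gives the polynomial coefficient bound
  \<open>|a\<^sub>n|\<^sup>p \<le> n\<^sup>p\<^sup>+\<^sup>1 \<parallel>P\<parallel>\<^sup>p\<close> (\<open>norm_coeff_le_torus_mean\<close>).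

  To pass to general \<open>f\<close>, choose polynomials that converge to \<open>f\<close> geometrically fast. By the subharmonicity
  bound and Borel--Cantelli, for almost every \<open>\<chi>\<close> their vertical limits converge locally uniformly on the
  right half-plane. By the coefficient bound the limit is the sum of the Dirichlet series far to the
  right, so it is the analytic continuation \<open>f\<^sub>\<chi>\<close>; Fatou's lemma transfers the contraction.
\<close>

section \<open>Haar measure on the circle\<close>

lemma cis_measurable [measurable]: "cis \<in> borel \<rightarrow>\<^sub>M restrict_space borel (sphere 0 1)"
  by (rule measurable_restrict_space2) (auto intro!: borel_measurable_continuous_onI continuous_intros)

lemma space_circle_haar [simp]: "space circle_haar = sphere 0 1"
  by (simp add: circle_haar_def space_restrict_space)

lemma sets_circle_haar [measurable_cong]: "sets circle_haar = sets (restrict_space borel (sphere 0 1))"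
  by (simp add: circle_haar_def)

lemma prob_space_uniform_0_2pi: "prob_space (uniform_measure lborel {0..2 * pi})"
  by (rule prob_space_uniform_measure) (auto simp: emeasure_lborel_Icc_eq)

lemma prob_space_circle_haar: "prob_space circle_haar"
proof -
  interpret prob_space "uniform_measure lborel {0..2 * pi}"
    by (rule prob_space_uniform_0_2pi)
  show ?thesis unfolding circle_haar_def
    by (rule prob_space_distr) (simp add: cis_measurable)
qed

interpretation circle: prob_space circle_haar
  by (rule prob_space_circle_haar)

lemma uniform_0_2pi_eq_density:
  "uniform_measure lborel {0..2 * pi} = density lborel (\<lambda>x. ennreal (indicator {0..2 * pi} x / (2 * pi)))"
  unfolding uniform_measure_def
  by (rule density_cong)
     (auto simp: emeasure_lborel_Icc_eq indicator_def divide_ennreal[symmetric] ennreal_mult''[symmetric])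

lemma nn_integral_circle_haar:
  assumes f [measurable]: "f \<in> borel_measurable (restrict_space borel (sphere 0 1))"
  shows "(\<integral>\<^sup>+ u. f u \<partial>circle_haar) =
    ennreal (1 / (2 * pi)) * (\<integral>\<^sup>+ x. f (cis x) * indicator {0..<2 * pi} x \<partial>lborel)"
proof -
  have [measurable]: "(\<lambda>x. f (cis x)) \<in> borel_measurable borel"
    by measurable
  have "(\<integral>\<^sup>+ u. f u \<partial>circle_haar) =
      (\<integral>\<^sup>+ x. ennreal (indicator {0..2 * pi} x / (2 * pi)) * f (cis x) \<partial>lborel)"
    unfolding circle_haar_def uniform_0_2pi_eq_density
    by (subst nn_integral_distr) (auto simp: nn_integral_density)
  also have "\<dots> = (\<integral>\<^sup>+ x. ennreal (1 / (2 * pi)) * (f (cis x) * indicator {0..<2 * pi} x) \<partial>lborel)"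
    by (rule nn_integral_cong_AE) (use AE_lborel_singleton[of "2 * pi"] in eventually_elim, auto simp: indicator_def)
  also have "\<dots> = ennreal (1 / (2 * pi)) * (\<integral>\<^sup>+ x. f (cis x) * indicator {0..<2 * pi} x \<partial>lborel)"
    by (rule nn_integral_cmult) measurable
  finally show ?thesis .
qed

lemma nn_integral_shift_period:
  fixes g :: "real \<Rightarrow> ennreal"
  assumes g [measurable]: "g \<in> borel_measurable borel" and per: "\<And>x. g (x + T) = g x"
    and a: "0 \<le> a" "a \<le> T"
  shows "(\<integral>\<^sup>+ x. g (x + a) * indicator {0..<T} x \<partial>lborel) = (\<integral>\<^sup>+ x. g x * indicator {0..<T} x \<partial>lborel)"
proof -
  have shift: "(\<integral>\<^sup>+ x. h (x + b) \<partial>lborel) = (\<integral>\<^sup>+ x. h x \<partial>lborel)"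
    if [measurable]: "h \<in> borel_measurable borel" for h :: "real \<Rightarrow> ennreal" and b
    using nn_integral_real_affine[of h 1 b] by (simp add: add.commute)
  have "(\<integral>\<^sup>+ x. g (x + a) * indicator {0..<T} x \<partial>lborel)
      = (\<integral>\<^sup>+ x. g (x + a) * indicator {a..<T + a} (x + a) \<partial>lborel)"
    by (rule nn_integral_cong) (auto simp: indicator_def)
  also have "\<dots> = (\<integral>\<^sup>+ x. g x * indicator {a..<T + a} x \<partial>lborel)"
    by (rule shift[of "\<lambda>x. g x * indicator {a..<T + a} x"]) measurable
  also have "\<dots> = (\<integral>\<^sup>+ x. g x * indicator {a..<T} x + g x * indicator {T..<T + a} x \<partial>lborel)"
    using a by (intro nn_integral_cong) (auto simp: indicator_def)
  also have "\<dots> = (\<integral>\<^sup>+ x. g x * indicator {a..<T} x \<partial>lborel) + (\<integral>\<^sup>+ x. g x * indicator {T..<T + a} x \<partial>lborel)"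
    by (rule nn_integral_add) measurable
  also have "(\<integral>\<^sup>+ x. g x * indicator {T..<T + a} x \<partial>lborel)
      = (\<integral>\<^sup>+ x. g (x + T) * indicator {T..<T + a} (x + T) \<partial>lborel)"
    by (rule shift[symmetric, of "\<lambda>x. g x * indicator {T..<T + a} x"]) measurable
  also have "\<dots> = (\<integral>\<^sup>+ x. g x * indicator {0..<a} x \<partial>lborel)"
    by (rule nn_integral_cong) (auto simp: indicator_def per)
  also have "(\<integral>\<^sup>+ x. g x * indicator {a..<T} x \<partial>lborel) + (\<integral>\<^sup>+ x. g x * indicator {0..<a} x \<partial>lborel)
      = (\<integral>\<^sup>+ x. g x * indicator {a..<T} x + g x * indicator {0..<a} x \<partial>lborel)"
    by (rule nn_integral_add[symmetric]) measurable
  also have "\<dots> = (\<integral>\<^sup>+ x. g x * indicator {0..<T} x \<partial>lborel)"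
    using a by (intro nn_integral_cong) (auto simp: indicator_def)
  finally show ?thesis .
qed

lemma rotation_measurable:
  assumes "cmod w = 1"
  shows "(\<lambda>u. w * u) \<in> restrict_space borel (sphere 0 1) \<rightarrow>\<^sub>M restrict_space borel (sphere 0 1)"
  using assms by (intro measurable_restrict_space3) (auto simp: norm_mult)

lemma distr_circle_haar_rotation:
  assumes w: "cmod w = 1"
  shows "distr circle_haar circle_haar (\<lambda>u. w * u) = circle_haar"
proof (rule measure_eqI)
  have [measurable]: "(\<lambda>u. w * u) \<in> restrict_space borel (sphere 0 1) \<rightarrow>\<^sub>M restrict_space borel (sphere 0 1)"
    by (rule rotation_measurable[OF w])
  fix B assume "B \<in> sets (distr circle_haar circle_haar (\<lambda>u. w * u))"
  then have B [measurable]: "B \<in> sets (restrict_space borel (sphere 0 1))"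
    by (simp add: sets_circle_haar)
  obtain a where a: "0 \<le> a" "a < 2 * pi" "w = cis a"
    using w Arg2pi_ge_0[of w] Arg2pi_lt_2pi[of w] Arg2pi_eq[of w]
    by (metis cis_conv_exp mult_1 of_real_1)
  have ind: "indicator B \<in> borel_measurable (restrict_space borel (sphere 0 1))"
    by measurable
  have "emeasure (distr circle_haar circle_haar (\<lambda>u. w * u)) B
      = (\<integral>\<^sup>+ u. indicator B u \<partial>distr circle_haar circle_haar (\<lambda>u. w * u))"
    by (rule nn_integral_indicator[symmetric]) (simp add: sets_circle_haar)
  also have "\<dots> = (\<integral>\<^sup>+ u. indicator B (w * u) \<partial>circle_haar)"
    by (rule nn_integral_distr) (measurable)
  also have "\<dots> = ennreal (1 / (2 * pi)) * (\<integral>\<^sup>+ x. indicator B (w * cis x) * indicator {0..<2 * pi} x \<partial>lborel)"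
    by (rule nn_integral_circle_haar) measurable
  also have "(\<lambda>x. indicator B (w * cis x)) = (\<lambda>x. indicator B (cis (x + a)) :: ennreal)"
    using a by (simp add: cis_mult add.commute)
  also have "(\<integral>\<^sup>+ x. indicator B (cis (x + a)) * indicator {0..<2 * pi} x \<partial>lborel)
      = (\<integral>\<^sup>+ x. indicator B (cis x) * indicator {0..<2 * pi} x \<partial>lborel)"
    using a by (intro nn_integral_shift_period[of "\<lambda>x. indicator B (cis x)"])
      (measurable, auto simp flip: cis_mult)
  also have "ennreal (1 / (2 * pi)) * \<dots> = (\<integral>\<^sup>+ u. indicator B u \<partial>circle_haar)"
    by (rule nn_integral_circle_haar[symmetric]) measurable
  also have "\<dots> = emeasure circle_haar B"
    by (rule nn_integral_indicator) (simp add: sets_circle_haar)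
  finally show "emeasure (distr circle_haar circle_haar (\<lambda>u. w * u)) B = emeasure circle_haar B" .
qed simp

lemma circle_borel_measurable:
  "f \<in> borel_measurable borel \<Longrightarrow> f \<in> borel_measurable circle_haar"
  by (simp add: measurable_cong_sets[OF sets_circle_haar] measurable_restrict_space1)

lemma AE_circle_haar_neq: "AE u in circle_haar. u \<noteq> w"
proof -
  have "AE x in uniform_measure lborel {0..2 * pi}. cis x \<noteq> w"
  proof (rule AE_uniform_measureI)
    have sub: "{x\<in>{0..<2*pi}. cis x = w} \<subseteq> {Arg2pi w}"
      by (auto intro!: Arg2pi_unique[of 1, symmetric] simp: cis_conv_exp)
    have "AE x in lborel. x \<noteq> 2 * pi \<and> x \<noteq> Arg2pi w"
      using AE_lborel_singleton[of "2 * pi"] AE_lborel_singleton[of "Arg2pi w"] by eventually_elim auto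
    then show "AE x in lborel. x \<in> {0..2 * pi} \<longrightarrow> cis x \<noteq> w"
      by (rule eventually_mono) (use sub in force)
  qed simp
  then show ?thesis
    unfolding circle_haar_def by (subst AE_distr_iff) (auto simp: pred_def space_restrict_space sets_restrict_space)
qed

lemma integral_circle_haar:
  fixes f :: "complex \<Rightarrow> real"
  assumes cont: "continuous_on (sphere 0 1) f"
  shows "(LINT u|circle_haar. f u) = integral {0..1} (\<lambda>x. f (cis (2 * pi * x)))"
proof -
  have [measurable]: "f \<in> borel_measurable (restrict_space borel (sphere 0 1))"
    by (rule borel_measurable_continuous_on_restrict[OF cont])
  have cont': "continuous_on UNIV (\<lambda>x. f (cis (2 * pi * x)))"
    by (rule continuous_on_compose2[OF cont]) (auto intro!: continuous_intros)
  have "(LINT u|circle_haar. f u) = (LINT x|lborel. (indicator {0..2 * pi} x / (2 * pi)) * f (cis x))"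
    unfolding circle_haar_def uniform_0_2pi_eq_density
    by (subst integral_distr) (auto simp: integral_density)
  also have "\<dots> = \<bar>2 * pi\<bar> * (LINT x|lborel. indicator {0..2 * pi} (0 + 2 * pi * x) / (2 * pi) * f (cis (0 + 2 * pi * x)))"
    using lborel_integral_real_affine[of "2 * pi" "\<lambda>x. indicator {0..2 * pi} x / (2 * pi) * f (cis x)" 0]
    by simp
  also have "\<dots> = (LINT x|lborel. (2 * pi) * (indicator {0..2 * pi} (0 + 2 * pi * x) / (2 * pi) * f (cis (0 + 2 * pi * x))))"
    by simp
  also have "\<dots> = (LINT x:{0..1}|lborel. f (cis (2 * pi * x)))"
    unfolding set_lebesgue_integral_def
    by (intro Bochner_Integration.integral_cong) (auto simp: indicator_def mult_le_cancel_left zero_le_mult_iff not_le[of pi 0] pi_gt_zero)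
  also have "\<dots> = integral {0..1} (\<lambda>x. f (cis (2 * pi * x)))"
    by (rule set_borel_integral_eq_integral)
       (unfold set_integrable_def, intro borel_integrable_compact continuous_on_subset[OF cont'], auto)
  finally show ?thesis .
qed

section \<open>Subharmonicity of powers of the modulus\<close>

text \<open>Each factor \<open>z - a\<close> with \<open>a\<close> in the open disc is replaced by \<open>1 - cnj a * z\<close>, which does not
  vanish in the disc and has the same modulus on the circle and a larger one inside. This is
  division by a Blaschke product. A nonvanishing function has holomorphic powers \<open>h powr p\<close>, also for
  small \<open>p\<close>, to which the Cauchy formula applies.\<close>
lemma nonvanishing_majorant:
  fixes g :: "complex poly"
  assumes "g \<noteq> 0"
  obtains h where "h holomorphic_on UNIV" "\<And>z. cmod z < 1 \<Longrightarrow> h z \<noteq> 0"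
    "\<And>z. cmod z = 1 \<Longrightarrow> cmod (h z) = cmod (poly g z)"
    "\<And>z. cmod z < 1 \<Longrightarrow> cmod (poly g z) \<le> cmod (h z)"
proof -
  obtain A where A: "g = smult (lead_coeff g) (\<Prod>x\<in>#A. [:-x, 1:])"
    using alg_closed_imp_factorization[OF assms] by blast
  define b where "b a z = (if cmod a < 1 then 1 - cnj a * z else z - a)" for a z
  have b_hol: "b a holomorphic_on UNIV" for a
    unfolding b_def by (cases "cmod a < 1") (auto intro!: holomorphic_intros)
  have b_nz: "b a z \<noteq> 0" if "cmod z < 1" for a z
  proof (cases "cmod a < 1")
    case True
    then have "cmod (cnj a * z) < 1"
      using that by (simp add: norm_mult le_less_trans[OF mult_left_le_one_le])
    then show ?thesis using True by (auto simp: b_def)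
  qed (use that in \<open>auto simp: b_def\<close>)
  have key: "(cmod (1 - cnj a * z))\<^sup>2 - (cmod (z - a))\<^sup>2 = (1 - (cmod a)\<^sup>2) * (1 - (cmod z)\<^sup>2)" for a z
    unfolding cmod_power2 by (simp add: algebra_simps power2_eq_square)
  have b_eq: "cmod (b a z) = cmod (z - a)" if "cmod z = 1" for a z
    using key[of a z] that by (auto simp: b_def)
  have b_ge: "cmod (z - a) \<le> cmod (b a z)" if "cmod z < 1" for a z
  proof (cases "cmod a < 1")
    case True
    then have "0 \<le> (1 - (cmod a)\<^sup>2) * (1 - (cmod z)\<^sup>2)"
      using that by (intro mult_nonneg_nonneg) (auto simp: abs_square_le_1)
    then have "(cmod (z - a))\<^sup>2 \<le> (cmod (1 - cnj a * z))\<^sup>2"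
      using key[of a z] by linarith
    then show ?thesis using True by (auto simp: b_def intro: power2_le_imp_le)
  qed (auto simp: b_def)
  define h where "h z = lead_coeff g * (\<Prod>a\<in>#A. b a z)" for z
  have prod_poly: "poly (\<Prod>x\<in>#A. [:-x, 1:]) z = (\<Prod>a\<in>#A. z - a)" for z
    by (induction A) (auto simp: algebra_simps)
  have g_eq: "poly g z = lead_coeff g * (\<Prod>a\<in>#A. z - a)" for z
    by (subst A) (simp add: prod_poly)
  show ?thesis
  proof
    have "(\<lambda>z. \<Prod>a\<in>#A. b a z) holomorphic_on UNIV"
      by (induction A) (auto intro!: holomorphic_intros b_hol)
    then show "h holomorphic_on UNIV"
      unfolding h_def by (intro holomorphic_intros)
    have "(\<Prod>a\<in>#A. b a z) \<noteq> 0" if "cmod z < 1" for z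
      using b_nz[OF that] by (induction A) auto
    then show "h z \<noteq> 0" if "cmod z < 1" for z
      using assms that by (auto simp: h_def)
    have "cmod (\<Prod>a\<in>#A. b a z) = cmod (\<Prod>a\<in>#A. z - a)" if "cmod z = 1" for z
      using b_eq[OF that] by (induction A) (auto simp: norm_mult)
    then show "cmod (h z) = cmod (poly g z)" if "cmod z = 1" for z
      using that by (simp add: h_def g_eq norm_mult)
    have "cmod (\<Prod>a\<in>#A. z - a) \<le> cmod (\<Prod>a\<in>#A. b a z)" if "cmod z < 1" for z
      using b_ge[OF that] by (induction A) (auto simp: norm_mult intro: mult_mono)
    then show "cmod (poly g z) \<le> cmod (h z)" if "cmod z < 1" for z
      using that by (auto simp: h_def g_eq norm_mult intro: mult_left_mono)
  qed
qed

lemma Cauchy_bound_circle_mean: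
  assumes hol: "k holomorphic_on ball 0 1" and r: "0 < r" "r < 1" and z: "cmod z < r"
  shows "cmod (k z) \<le> r / (r - cmod z) * (LINT u|circle_haar. cmod (k (of_real r * u)))"
proof -
  have cont: "continuous_on (ball 0 1) k"
    using hol holomorphic_on_imp_continuous_on by blast
  have contr: "continuous_on (sphere 0 1) (\<lambda>u. k (of_real r * u))"
    using r by (intro continuous_on_compose2[OF cont] continuous_intros) (auto simp: norm_mult)
  have "((\<lambda>u. k u / (u - z)) has_contour_integral (2 * of_real pi * \<i> * k z)) (circlepath 0 r)"
    using r z by (intro Cauchy_integral_circlepath_simple holomorphic_on_subset[OF hol]) auto
  then have int: "((\<lambda>x. k (r * cis (2 * pi * x)) / (r * cis (2 * pi * x) - z) * (2 * pi * \<i> * r * cis (2 * pi * x)))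
      has_integral (2 * of_real pi * \<i> * k z)) {0..1}"
    unfolding has_contour_integral vector_derivative_circlepath
    by (simp add: circlepath cis_conv_exp mult_ac)
  have contc: "continuous_on {0..1} (\<lambda>x::real. cmod (k (of_real r * cis (2 * pi * x))))"
    by (rule continuous_on_compose2[OF continuous_on_norm[OF contr]]) (auto intro!: continuous_intros)
  have "cmod (2 * of_real pi * \<i> * k z) \<le> integral {0..1} (\<lambda>x. 2 * pi * (r / (r - cmod z)) * cmod (k (of_real r * cis (2 * pi * x))))"
    unfolding integral_unique[OF int, symmetric]
  proof (rule integral_norm_bound_integral)
    fix x :: real
    have "r - cmod z \<le> cmod (of_real r * cis (2 * pi * x) - z)"
      using norm_triangle_ineq2[of "of_real r * cis (2 * pi * x)" z] r by (simp add: norm_mult)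
    then have "cmod (k (r * cis (2 * pi * x))) / cmod (r * cis (2 * pi * x) - z) \<le> cmod (k (r * cis (2 * pi * x))) / (r - cmod z)"
      using z by (intro divide_left_mono mult_pos_pos) auto
    then have "cmod (k (r * cis (2 * pi * x))) / cmod (r * cis (2 * pi * x) - z) * (2 * pi * r) \<le> cmod (k (r * cis (2 * pi * x))) / (r - cmod z) * (2 * pi * r)"
      using r by (intro mult_right_mono) auto
    then show "cmod (k (r * cis (2 * pi * x)) / (r * cis (2 * pi * x) - z) * (2 * pi * \<i> * r * cis (2 * pi * x)))
        \<le> 2 * pi * (r / (r - cmod z)) * cmod (k (of_real r * cis (2 * pi * x)))"
      using r by (simp add: norm_mult norm_divide mult_ac)
    show "(\<lambda>x. k (r * cis (2 * pi * x)) / (r * cis (2 * pi * x) - z) * (2 * pi * \<i> * r * cis (2 * pi * x)))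
        integrable_on {0..1}"
      using int by (rule has_integral_integrable)
    show "(\<lambda>x. 2 * pi * (r / (r - cmod z)) * cmod (k (of_real r * cis (2 * pi * x)))) integrable_on {0..1}"
      by (intro integrable_continuous_real continuous_on_mult continuous_on_const contc)
  qed
  also have "\<dots> = 2 * pi * (r / (r - cmod z)) * integral {0..1} (\<lambda>x. cmod (k (of_real r * cis (2 * pi * x))))"
    by simp
  also have "integral {0..1} (\<lambda>x. cmod (k (of_real r * cis (2 * pi * x)))) = (LINT u|circle_haar. cmod (k (of_real r * u)))"
    by (rule integral_circle_haar[symmetric]) (intro continuous_intros contr)
  finally have "2 * pi * cmod (k z) \<le> 2 * pi * (r / (r - cmod z) * (LINT u|circle_haar. cmod (k (of_real r * u))))"
    by (simp add: norm_mult mult_ac)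
  then show ?thesis
    by (rule mult_left_le_imp_le) simp
qed

lemma circle_mean_tendsto:
  fixes f :: "nat \<Rightarrow> complex \<Rightarrow> complex"
  assumes "0 < p" and cont: "\<And>n. continuous_on (sphere 0 1) (f n)" "continuous_on (sphere 0 1) F"
    and bd: "\<And>n u. cmod u = 1 \<Longrightarrow> cmod (f n u) \<le> B"
    and lim: "AE u in circle_haar. (\<lambda>n. f n u) \<longlonglongrightarrow> F u"
  shows "(\<lambda>n. LINT u|circle_haar. cmod (f n u) powr p) \<longlonglongrightarrow> (LINT u|circle_haar. cmod (F u) powr p)"
proof (rule integral_dominated_convergence[where w = "\<lambda>_. B powr p"])
  have meas: "(\<lambda>u. cmod (g u) powr p) \<in> borel_measurable circle_haar"
    if "continuous_on (sphere 0 1) g" for g :: "complex \<Rightarrow> complex"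
    unfolding measurable_cong_sets[OF sets_circle_haar refl] using \<open>0 < p\<close>
    by (intro borel_measurable_continuous_on_restrict continuous_on_powr' continuous_intros that) auto
  show "(\<lambda>u. cmod (F u) powr p) \<in> borel_measurable circle_haar"
    "\<And>n. (\<lambda>u. cmod (f n u) powr p) \<in> borel_measurable circle_haar"
    by (intro meas cont)+
  show "AE u in circle_haar. (\<lambda>n. cmod (f n u) powr p) \<longlonglongrightarrow> cmod (F u) powr p"
    using lim by (rule eventually_mono) (use \<open>0 < p\<close> in \<open>auto intro!: tendsto_powr' tendsto_intros\<close>)
  show "AE u in circle_haar. norm (cmod (f n u) powr p) \<le> B powr p" for n
    using \<open>0 < p\<close> by (intro AE_I2) (auto intro!: powr_mono2 bd)
qed simp

text \<open>Zeros on the unit circle are not removed by the majorant, so that the holomorphic power exists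
  only in the open disc; the Cauchy bound is used on circles of radius below \<open>1\<close>, followed by a limit.\<close>
lemma poly_powr_le_circle_mean:
  assumes "0 < p" and z: "cmod z < 1"
  shows "cmod (poly g z) powr p \<le> 1 / (1 - cmod z) * (LINT u|circle_haar. cmod (poly g u) powr p)"
proof (cases "g = 0")
  case False
  obtain h where h: "h holomorphic_on UNIV" "\<And>z. cmod z < 1 \<Longrightarrow> h z \<noteq> 0"
    "\<And>z. cmod z = 1 \<Longrightarrow> cmod (h z) = cmod (poly g z)"
    "\<And>z. cmod z < 1 \<Longrightarrow> cmod (poly g z) \<le> cmod (h z)"
    using nonvanishing_majorant[OF False] by blast
  have conth: "continuous_on S h" for S
    using h(1) holomorphic_on_imp_continuous_on continuous_on_subset by blast
  obtain L where L: "L holomorphic_on ball 0 1" "\<And>z. z \<in> ball 0 1 \<Longrightarrow> exp (L z) = h z"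
    by (rule holomorphic_logarithm_exists[of "ball 0 1" h 0])
       (use h in \<open>auto intro: holomorphic_on_subset\<close>)
  define k where "k z = exp (of_real p * L z)" for z
  have k_hol: "k holomorphic_on ball 0 1"
    unfolding k_def by (intro holomorphic_intros L)
  have k_norm: "cmod (k z) = cmod (h z) powr p" if "cmod z < 1" for z
    using that h(2)[OF that] by (simp add: k_def powr_def flip: L(2))
  \<comment> \<open>Radii between \<open>|z|\<close> and \<open>1\<close> that tend to \<open>1\<close>.\<close>
  define r where "r n = 1 - (1 - cmod z) / (n + 2)" for n :: nat
  have r: "cmod z < r n" "0 < r n" "r n < 1" for n
  proof -
    have "(1 - cmod z) / (n + 2) < 1 - cmod z"
      using z divide_strict_left_mono[of 1 "real n + 2" "1 - cmod z"] by (simp add: add.commute)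
    then show "cmod z < r n" by (simp add: r_def)
    then show "0 < r n" using norm_ge_zero[of z] by linarith
    show "r n < 1" using z by (simp add: r_def)
  qed
  have r_lim: "r \<longlonglongrightarrow> 1"
    unfolding r_def by real_asymp
  have *: "cmod (h z) powr p \<le> r n / (r n - cmod z) * (LINT u|circle_haar. cmod (h (r n * u)) powr p)" for n
  proof -
    have "(LINT u|circle_haar. cmod (k (r n * u))) = (LINT u|circle_haar. cmod (h (r n * u)) powr p)"
      using r[of n] by (intro Bochner_Integration.integral_cong) (auto simp: k_norm norm_mult)
    then show ?thesis
      using Cauchy_bound_circle_mean[OF k_hol r(2,3,1)[of n]] z by (simp add: k_norm)
  qed
  obtain B where "\<forall>x\<in>h ` cball 0 1. cmod x \<le> B"
    using compact_imp_bounded[OF compact_continuous_image[OF conth compact_cball[of 0 1]]]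
    unfolding bounded_iff by blast
  then have B: "cmod (h u) \<le> B" if "u \<in> cball 0 1" for u
    using that by blast
  have bd: "cmod (h (of_real (r n) * u)) \<le> B" if "cmod u = 1" for n u
    using r[of n] that by (intro B) (auto simp: norm_mult)
  have "(\<lambda>n. h (of_real (r n) * u)) \<longlonglongrightarrow> h (of_real 1 * u)" for u
    by (rule continuous_on_tendsto_compose[OF conth[of UNIV] tendsto_mult[OF tendsto_of_real[OF r_lim] tendsto_const]]) auto
  then have lim: "AE u in circle_haar. (\<lambda>n. h (of_real (r n) * u)) \<longlonglongrightarrow> h u"
    by simp
  have cont: "continuous_on (sphere 0 1) (\<lambda>u. h (of_real (r n) * u))" for n
    by (auto intro!: continuous_on_compose2[OF conth[of UNIV]] continuous_intros)
  have "(\<lambda>n. LINT u|circle_haar. cmod (h (r n * u)) powr p) \<longlonglongrightarrow> (LINT u|circle_haar. cmod (h u) powr p)"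
    by (rule circle_mean_tendsto[OF \<open>0 < p\<close> cont conth bd lim])
  then have "(\<lambda>n. r n / (r n - cmod z) * (LINT u|circle_haar. cmod (h (r n * u)) powr p))
      \<longlonglongrightarrow> 1 / (1 - cmod z) * (LINT u|circle_haar. cmod (h u) powr p)"
    using z by (intro tendsto_intros r_lim) auto
  then have "cmod (h z) powr p \<le> 1 / (1 - cmod z) * (LINT u|circle_haar. cmod (h u) powr p)"
    by (rule LIMSEQ_le_const) (use * in auto)
  also have "(LINT u|circle_haar. cmod (h u) powr p) = (LINT u|circle_haar. cmod (poly g u) powr p)"
    by (intro Bochner_Integration.integral_cong) (auto simp: h)
  finally show ?thesis
    using powr_mono2[OF _ _ h(4)[OF z], of p] \<open>0 < p\<close> by simp
qed simp

text \<open>Taylor polynomials reduce this to the polynomial case. For \<open>z = 0\<close> it is the sub-mean value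
  property; the other points give locally uniform bounds from means over a circle.\<close>
lemma holomorphic_powr_le_circle_mean:
  assumes "0 < p" and z: "cmod z < 1" and hol: "G holomorphic_on ball 0 R" and R: "1 < R"
  shows "cmod (G z) powr p \<le> 1 / (1 - cmod z) * (LINT u|circle_haar. cmod (G u) powr p)"
proof -
  define c where "c n = (deriv ^^ n) G 0 / fact n" for n
  define g where "g n = (\<Sum>i<n. monom (c i) i)" for n
  have g_eq: "poly (g n) w = (\<Sum>i<n. c i * w ^ i)" for n w
    by (simp add: g_def poly_sum poly_monom)
  have sums: "(\<lambda>i. c i * w ^ i) sums G w" if "cmod w < R" for w
    using holomorphic_power_series[OF hol, of w] that by (simp add: c_def)
  have lim: "(\<lambda>n. poly (g n) w) \<longlonglongrightarrow> G w" if "cmod w < R" for w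
    using sums[OF that] by (simp add: g_eq sums_def)
  obtain \<rho> where \<rho>: "1 < \<rho>" "\<rho> < R" using R dense by blast
  have "summable (\<lambda>i. c i * of_real \<rho> ^ i)"
    using sums[of "of_real \<rho>"] \<rho> sums_summable by auto
  then have summ: "summable (\<lambda>i. cmod (c i * 1 ^ i))"
    using \<rho> by (intro powser_insidea[of c "of_real \<rho>"]) auto
  define B where "B = (\<Sum>i. cmod (c i))"
  have bd: "cmod (poly (g n) u) \<le> B" if "cmod u = 1" for n u
  proof -
    have "cmod (poly (g n) u) \<le> (\<Sum>i<n. cmod (c i))"
      unfolding g_eq using that by (intro order_trans[OF norm_sum] sum_mono) (auto simp: norm_mult norm_power)
    also have "\<dots> \<le> B"
      unfolding B_def using summ by (intro sum_le_suminf) auto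
    finally show ?thesis .
  qed
  have contG: "continuous_on (sphere 0 1) G"
    using R by (intro continuous_on_subset[OF holomorphic_on_imp_continuous_on[OF hol]]) auto
  have "(\<lambda>n. 1 / (1 - cmod z) * (LINT u|circle_haar. cmod (poly (g n) u) powr p))
      \<longlonglongrightarrow> 1 / (1 - cmod z) * (LINT u|circle_haar. cmod (G u) powr p)"
    using R by (intro tendsto_mult tendsto_const circle_mean_tendsto[OF \<open>0 < p\<close> _ contG bd])
      (auto intro!: continuous_intros lim AE_I2)
  moreover have "(\<lambda>n. cmod (poly (g n) z) powr p) \<longlonglongrightarrow> cmod (G z) powr p"
    using R z \<open>0 < p\<close> by (intro tendsto_powr' tendsto_intros lim) auto
  moreover have "cmod (poly (g n) z) powr p \<le> 1 / (1 - cmod z) * (LINT u|circle_haar. cmod (poly (g n) u) powr p)" for n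
    by (rule poly_powr_le_circle_mean[OF \<open>0 < p\<close> z])
  ultimately show ?thesis
    using LIMSEQ_le by blast
qed

section \<open>Means of character sums on the torus\<close>
interpretation torus: product_prob_space "\<lambda>_::nat. circle_haar" UNIV
  by unfold_locales

interpretation torus_haar: prob_space torus_haar
  unfolding torus_haar_def by (rule torus.prob_space_axioms)

lemma space_torus_haar: "space torus_haar = {chi. \<forall>j. cmod (chi j) = 1}"
  by (auto simp: torus_haar_def space_PiM PiE_def Pi_def)

lemma torus_component_measurable [measurable]: "(\<lambda>chi. chi j) \<in> torus_haar \<rightarrow>\<^sub>M circle_haar"
  unfolding torus_haar_def by measurable

lemma torus_component_borel [measurable]: "(\<lambda>chi. chi j) \<in> borel_measurable torus_haar"
  by (rule measurable_compose[OF torus_component_measurable])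
     (auto intro: circle_borel_measurable)

lemma torus_rotation_measurable:
  assumes "\<And>j. cmod (u j) = 1"
  shows "(\<lambda>chi j. u j * chi j) \<in> torus_haar \<rightarrow>\<^sub>M torus_haar"
proof -
  have "(\<lambda>z. u j * z) \<in> circle_haar \<rightarrow>\<^sub>M circle_haar" for j
    using rotation_measurable[OF assms] by (simp add: measurable_cong_sets[OF sets_circle_haar sets_circle_haar])
  then have "(\<lambda>chi. \<lambda>j\<in>UNIV. u j * chi j) \<in> torus_haar \<rightarrow>\<^sub>M (\<Pi>\<^sub>M j\<in>UNIV. circle_haar)"
    by (intro measurable_restrict measurable_compose[OF torus_component_measurable])
  then show ?thesis by (simp add: torus_haar_def restrict_def)
qed

lemma distr_torus_haar_rotation:
  assumes u: "\<And>j. cmod (u j) = 1"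
  shows "distr torus_haar torus_haar (\<lambda>chi j. u j * chi j) = torus_haar"
proof -
  note rot = torus_rotation_measurable[OF u]
  have rotc: "(\<lambda>z. u j * z) \<in> circle_haar \<rightarrow>\<^sub>M circle_haar" for j
    using rotation_measurable[OF u] by (simp add: measurable_cong_sets[OF sets_circle_haar sets_circle_haar])
  have "distr torus_haar torus_haar (\<lambda>chi j. u j * chi j) = (\<Pi>\<^sub>M j\<in>(UNIV :: nat set). circle_haar)"
  proof (rule torus.PiM_eq)
    fix J :: "nat set" and F assume J: "finite J" and F: "\<And>j. j \<in> J \<Longrightarrow> F j \<in> sets circle_haar"
    define F' where "F' j = (\<lambda>z. u j * z) -` F j \<inter> space circle_haar" for j
    have F': "F' j \<in> sets circle_haar" if "j \<in> J" for j
      unfolding F'_def by (rule measurable_sets[OF rotc F[OF that]])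
    have emb: "prod_emb UNIV (\<lambda>_. circle_haar) J (Pi\<^sub>E J F) \<in> sets torus_haar"
      unfolding torus_haar_def using J F by (intro sets_PiM_I) auto
    have "emeasure (distr torus_haar torus_haar (\<lambda>chi j. u j * chi j)) (prod_emb UNIV (\<lambda>_. circle_haar) J (Pi\<^sub>E J F))
        = emeasure torus_haar ((\<lambda>chi j. u j * chi j) -` prod_emb UNIV (\<lambda>_. circle_haar) J (Pi\<^sub>E J F) \<inter> space torus_haar)"
      by (rule emeasure_distr[OF rot emb])
    also have "(\<lambda>chi j. u j * chi j) -` prod_emb UNIV (\<lambda>_. circle_haar) J (Pi\<^sub>E J F) \<inter> space torus_haar
        = prod_emb UNIV (\<lambda>_. circle_haar) J (Pi\<^sub>E J F')"
      by (auto simp: prod_emb_def space_torus_haar F'_def u norm_mult PiE_def Pi_def restrict_def extensional_def)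
    also have "emeasure torus_haar \<dots> = (\<Prod>j\<in>J. emeasure circle_haar (F' j))"
      unfolding torus_haar_def using J F' by (intro torus.emeasure_PiM_emb) auto
    also have "\<dots> = (\<Prod>j\<in>J. emeasure circle_haar (F j))"
    proof (intro prod.cong refl)
      fix j assume "j \<in> J"
      have "emeasure circle_haar (F' j) = emeasure (distr circle_haar circle_haar (\<lambda>z. u j * z)) (F j)"
        unfolding F'_def by (rule emeasure_distr[OF rotc F[OF \<open>j \<in> J\<close>], symmetric])
      then show "emeasure circle_haar (F' j) = emeasure circle_haar (F j)"
        by (simp add: distr_circle_haar_rotation[OF u])
    qed
    finally show "emeasure (distr torus_haar torus_haar (\<lambda>chi j. u j * chi j)) (prod_emb UNIV (\<lambda>_. circle_haar) J (Pi\<^sub>E J F))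
        = (\<Prod>j\<in>J. emeasure circle_haar (F j))" .
  qed (simp add: torus_haar_def)
  then show ?thesis by (simp add: torus_haar_def)
qed

lemma integral_torus_rotation:
  fixes f :: "(nat \<Rightarrow> complex) \<Rightarrow> real"
  assumes "\<And>j. cmod (u j) = 1" and "f \<in> borel_measurable torus_haar"
  shows "(LINT chi|torus_haar. f (\<lambda>j. u j * chi j)) = (LINT chi|torus_haar. f chi)"
  using integral_distr[OF torus_rotation_measurable[OF assms(1)] assms(2)]
  by (simp add: distr_torus_haar_rotation[OF assms(1)])

lemma mult_char_measurable [measurable]: "(\<lambda>chi. mult_char chi n) \<in> borel_measurable torus_haar"
  unfolding mult_char_def by measurable

lemma norm_mult_char: "chi \<in> space torus_haar \<Longrightarrow> cmod (mult_char chi n) = 1"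
  by (auto simp: mult_char_def prod_norm[symmetric] norm_power space_torus_haar)

lemma mult_char_mult: "mult_char (\<lambda>j. u j * chi j) n = mult_char u n * mult_char chi n"
  by (simp add: mult_char_def prod.distrib power_mult_distrib)

text \<open>The completely additive function with value \<open>lam j\<close> at the prime \<open>nth_prime j\<close>. Rotating the
  coordinates of the torus by \<open>exp (- \<i> * lam j * t)\<close> multiplies the character at \<open>n\<close> by
  \<open>exp (- \<i> * additive_weight lam n * t)\<close>.\<close>
definition additive_weight :: "(nat \<Rightarrow> real) \<Rightarrow> nat \<Rightarrow> real" where
  "additive_weight lam n = (\<Sum>j | nth_prime j dvd n. lam j * real (multiplicity (nth_prime j) n))"

lemma mult_char_exp:
  "mult_char (\<lambda>j. exp (of_real (lam j) * z)) n = exp (of_real (additive_weight lam n) * z)"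
  unfolding mult_char_def additive_weight_def
  by (cases "finite {j. nth_prime j dvd n}")
     (simp_all add: exp_sum sum_distrib_left exp_of_nat_mult[symmetric] mult_ac)

definition torus_mean :: "real \<Rightarrow> nat set \<Rightarrow> (nat \<Rightarrow> complex) \<Rightarrow> real" where
  "torus_mean p A a = (LINT chi|torus_haar. cmod (\<Sum>n\<in>A. a n * mult_char chi n) powr p)"

lemma torus_mean_nonneg: "0 \<le> torus_mean p A a"
  by (simp add: torus_mean_def)

lemma norm_char_sum_le:
  "chi \<in> space torus_haar \<Longrightarrow> cmod (\<Sum>n\<in>A. a n * mult_char chi n) \<le> (\<Sum>n\<in>A. cmod (a n))"
  by (rule order_trans[OF norm_sum]) (simp add: norm_mult norm_mult_char)

lemma char_sum_measurable:
  "(\<lambda>chi. cmod (\<Sum>n\<in>A. a n * mult_char chi n) powr p) \<in> borel_measurable torus_haar"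
  by measurable

lemma integrable_torus_mean:
  assumes "0 < p"
  shows "integrable torus_haar (\<lambda>chi. cmod (\<Sum>n\<in>A. a n * mult_char chi n) powr p)"
proof (rule torus_haar.integrable_const_bound[where B = "(\<Sum>n\<in>A. cmod (a n)) powr p"])
  show "AE chi in torus_haar. norm (cmod (\<Sum>n\<in>A. a n * mult_char chi n) powr p) \<le> (\<Sum>n\<in>A. cmod (a n)) powr p"
    using assms by (intro AE_I2) (auto intro!: powr_mono2 norm_char_sum_le)
qed measurable

lemma torus_mean_tendsto:
  assumes "0 < p" "\<And>k n. n \<in> A \<Longrightarrow> cmod (b k n) \<le> B n" "\<And>n. n \<in> A \<Longrightarrow> (\<lambda>k. b k n) \<longlonglongrightarrow> a n"
  shows "(\<lambda>k. torus_mean p A (b k)) \<longlonglongrightarrow> torus_mean p A a"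
  unfolding torus_mean_def
proof (rule integral_dominated_convergence[where w = "\<lambda>_. (\<Sum>n\<in>A. B n) powr p"])
  show "AE chi in torus_haar. norm (cmod (\<Sum>n\<in>A. b k n * mult_char chi n) powr p) \<le> (\<Sum>n\<in>A. B n) powr p" for k
    using assms(1,2) by (intro AE_I2) (auto intro!: powr_mono2 order_trans[OF norm_char_sum_le] sum_mono)
  show "AE chi in torus_haar. (\<lambda>k. cmod (\<Sum>n\<in>A. b k n * mult_char chi n) powr p) \<longlonglongrightarrow> cmod (\<Sum>n\<in>A. a n * mult_char chi n) powr p"
    using assms(1,3) by (intro AE_I2 tendsto_powr' tendsto_intros) auto
qed (simp_all add: char_sum_measurable)

text \<open>The imaginary part of \<open>s\<close> is absorbed by a rotation of the torus, except for a common
  unimodular factor that comes from the constant \<open>c\<close>.\<close>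
lemma torus_mean_vertical_shift:
  "torus_mean p A (\<lambda>n. a n * exp (- of_real (additive_weight lam n + c) * s))
    = torus_mean p A (\<lambda>n. a n * exp (- of_real (additive_weight lam n + c) * of_real (Re s)))"
proof -
  define u where "u j = exp (of_real (lam j) * (- \<i> * of_real (Im s)))" for j
  have u: "cmod (u j) = 1" for j
    by (simp add: u_def)
  let ?W = "additive_weight lam"
  have eq: "cmod (\<Sum>n\<in>A. a n * exp (- of_real (?W n + c) * s) * mult_char chi n)
      = cmod (\<Sum>n\<in>A. a n * exp (- of_real (?W n + c) * of_real (Re s)) * mult_char (\<lambda>j. u j * chi j) n)" for chi
  proof -
    have "exp (- of_real (?W n + c) * s)
        = exp (- \<i> * of_real (c * Im s)) * (exp (- of_real (?W n + c) * of_real (Re s)) * mult_char u n)" for n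
      unfolding u_def mult_char_exp exp_add[symmetric]
      by (rule arg_cong[where f = exp]) (simp add: complex_eq_iff algebra_simps)
    then have "(\<Sum>n\<in>A. a n * exp (- of_real (?W n + c) * s) * mult_char chi n)
       = exp (- \<i> * of_real (c * Im s)) * (\<Sum>n\<in>A. a n * exp (- of_real (?W n + c) * of_real (Re s)) * mult_char (\<lambda>j. u j * chi j) n)"
      by (simp add: sum_distrib_left mult_char_mult mult_ac)
    then show ?thesis by (simp add: norm_mult)
  qed
  show ?thesis
    unfolding torus_mean_def eq
    by (rule integral_torus_rotation[OF u, of "\<lambda>chi. cmod (\<Sum>n\<in>A. a n * exp (- of_real (?W n + c) * of_real (Re s)) * mult_char chi n) powr p"])
       measurable
qed

text \<open>The map \<open>v \<mapsto> \<sigma> (1 + v) / (1 - v)\<close> takes the disc to the right half-plane, \<open>0\<close> to \<open>\<sigma>\<close> and the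
  circle without \<open>1\<close> to the imaginary axis. The sub-mean value property on circles of radius \<open>r < 1\<close>,
  averaged over the torus, bounds the mean at \<open>\<sigma>\<close> by means at real parts that tend to \<open>0\<close> as \<open>r\<close> tends
  to \<open>1\<close>.\<close>
lemma torus_mean_damped_le:
  assumes p: "0 < p" and W: "\<And>n. n \<in> A \<Longrightarrow> 0 \<le> additive_weight lam n + c" and \<sigma>: "0 < \<sigma>"
  shows "torus_mean p A (\<lambda>n. a n * exp (- of_real (additive_weight lam n + c) * of_real \<sigma>)) \<le> torus_mean p A a"
proof -
  let ?W = "\<lambda>n. additive_weight lam n + c"
  define b where "b s n = a n * exp (- of_real (?W n) * s)" for s n
  define \<phi> where "\<phi> v = of_real \<sigma> * (1 + v) / (1 - v)" for v :: complex
  define r :: "nat \<Rightarrow> real" where "r k = 1 - 1 / (k + 2)" for k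
  have r: "0 < r k" "r k < 1" for k by (auto simp: r_def field_simps)
  have r_lim: "r \<longlonglongrightarrow> 1" unfolding r_def by real_asymp
  have Re\<phi>: "Re (\<phi> v) = \<sigma> * (1 - (cmod v)\<^sup>2) / (cmod (1 - v))\<^sup>2" if "v \<noteq> 1" for v
  proof -
    have "\<phi> v = of_real \<sigma> * ((1 + v) * cnj (1 - v)) / (of_real ((cmod (1 - v))\<^sup>2))"
      using that unfolding \<phi>_def complex_norm_square by simp
    then have "Re (\<phi> v) = Re (of_real \<sigma> * ((1 + v) * cnj (1 - v))) / (cmod (1 - v))\<^sup>2"
      by (simp only: Re_divide_of_real)
    also have "Re (of_real \<sigma> * ((1 + v) * cnj (1 - v))) = \<sigma> * (1 - (cmod v)\<^sup>2)"
      unfolding cmod_power2 by (simp add: algebra_simps power2_eq_square)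
    finally show ?thesis .
  qed
  have Re\<phi>_nonneg: "0 \<le> Re (\<phi> v)" if "cmod v \<le> 1" for v
  proof (cases "v = 1")
    case False
    then show ?thesis
      using that \<sigma> by (simp add: Re\<phi> abs_square_le_1)
  qed (simp add: \<phi>_def)
  have b_le: "cmod (b s n) \<le> cmod (a n)" if "0 \<le> Re s" "n \<in> A" for s n
    using that W[OF that(2)] by (auto simp: b_def norm_mult intro!: mult_left_le mult_nonpos_nonneg)
  define M where "M x = torus_mean p A (b (of_real x))" for x :: real
  have M_eq: "torus_mean p A (b s) = M (Re s)" for s
    unfolding M_def b_def by (rule torus_mean_vertical_shift)
  have M_le: "M x \<le> (\<Sum>n\<in>A. cmod (a n)) powr p" if "0 \<le> x" for x
    unfolding M_def torus_mean_def
  proof (rule torus_haar.integral_le_const[OF integrable_torus_mean[OF p]])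
    show "AE chi in torus_haar. cmod (\<Sum>n\<in>A. b (of_real x) n * mult_char chi n) powr p \<le> (\<Sum>n\<in>A. cmod (a n)) powr p"
      using p that b_le by (intro AE_I2) (auto intro!: powr_mono2 order_trans[OF norm_char_sum_le] sum_mono)
  qed
  have M_lim: "(\<lambda>k. M (x k)) \<longlonglongrightarrow> M 0" if "\<And>k. 0 \<le> x k" "x \<longlonglongrightarrow> 0" for x
  proof -
    have "(\<lambda>k. torus_mean p A (b (of_real (max 0 (x k))))) \<longlonglongrightarrow> torus_mean p A (b (of_real 0))"
    proof (rule torus_mean_tendsto[OF p, where b = "\<lambda>k. b (of_real (max 0 (x k)))" and B = "\<lambda>n. cmod (a n)"])
      show "cmod (b (of_real (max 0 (x k))) n) \<le> cmod (a n)" if "n \<in> A" for k n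
        using that by (intro b_le) auto
      have "(\<lambda>k. b (of_real (max 0 (x k))) n) \<longlonglongrightarrow> b (of_real (max 0 0)) n" for n
        unfolding b_def using that(2) by (intro tendsto_intros)
      then show "(\<lambda>k. b (of_real (max 0 (x k))) n) \<longlonglongrightarrow> b (of_real 0) n" for n by simp
    qed
    then show ?thesis using that(1) by (simp add: M_def max_absorb2)
  qed
  have step: "M \<sigma> \<le> (LINT u|circle_haar. M (Re (\<phi> (of_real (r k) * u))))" for k
  proof -
    define f where "f = (\<lambda>(chi, u). cmod (\<Sum>n\<in>A. b (\<phi> (of_real (r k) * u)) n * mult_char chi n) powr p)"
    interpret P: pair_prob_space torus_haar circle_haar ..
    have [measurable]: "(\<lambda>u. u) \<in> borel_measurable circle_haar"
      by (rule circle_borel_measurable) simp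
    have f_meas: "f \<in> borel_measurable (torus_haar \<Otimes>\<^sub>M circle_haar)"
      unfolding f_def b_def \<phi>_def by measurable
    have f_int: "integrable (torus_haar \<Otimes>\<^sub>M circle_haar) f"
    proof (rule P.integrable_const_bound[where B = "(\<Sum>n\<in>A. cmod (a n)) powr p"])
      show "AE x in torus_haar \<Otimes>\<^sub>M circle_haar. norm (f x) \<le> (\<Sum>n\<in>A. cmod (a n)) powr p"
        using p r[of k] by (intro AE_I2)
          (auto simp: f_def space_pair_measure norm_mult
            intro!: powr_mono2 order_trans[OF norm_char_sum_le] sum_mono b_le Re\<phi>_nonneg)
    qed (rule f_meas)
    have "M \<sigma> \<le> (LINT chi|torus_haar. LINT u|circle_haar. f (chi, u))"
      unfolding M_def torus_mean_def
    proof (rule integral_mono[OF integrable_torus_mean[OF p]])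
      show "integrable torus_haar (\<lambda>chi. LINT u|circle_haar. f (chi, u))"
        using P.integrable_fst'[OF f_int] .
      fix chi assume "chi \<in> space torus_haar"
      define G where "G v = (\<Sum>n\<in>A. b (\<phi> (of_real (r k) * v)) n * mult_char chi n)" for v
      have "G holomorphic_on ball 0 (1 / r k)"
      proof -
        have "1 - of_real (r k) * v \<noteq> 0" if "v \<in> ball 0 (1 / r k)" for v :: complex
        proof
          assume "1 - of_real (r k) * v = 0"
          then have "cmod (of_real (r k) * v) = 1" by (metis eq_iff_diff_eq_0 norm_one)
          then show False using that r[of k] by (auto simp: norm_mult field_simps)
        qed
        then show ?thesis
          unfolding G_def b_def \<phi>_def by (intro holomorphic_intros) auto
      qed
      then have "cmod (G 0) powr p \<le> 1 / (1 - cmod 0) * (LINT u|circle_haar. cmod (G u) powr p)"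
        using r[of k] by (intro holomorphic_powr_le_circle_mean[OF p]) auto
      then show "cmod (\<Sum>n\<in>A. b (of_real \<sigma>) n * mult_char chi n) powr p \<le> (LINT u|circle_haar. f (chi, u))"
        by (simp add: G_def f_def \<phi>_def)
    qed
    also have "\<dots> = (LINT u|circle_haar. LINT chi|torus_haar. f (chi, u))"
      using P.Fubini_integral[of "\<lambda>chi u. f (chi, u)"] f_int by simp
    also have "\<dots> = (LINT u|circle_haar. M (Re (\<phi> (of_real (r k) * u))))"
      by (simp add: f_def torus_mean_def[symmetric] M_eq)
    finally show ?thesis .
  qed
  have M_meas: "M \<in> borel_measurable borel"
    unfolding M_def torus_mean_def b_def
    by (rule torus_haar.borel_measurable_lebesgue_integral) measurable
  have "(\<lambda>k. LINT u|circle_haar. M (Re (\<phi> (of_real (r k) * u)))) \<longlonglongrightarrow> (LINT u|circle_haar. M 0)"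
  proof (rule integral_dominated_convergence[where w = "\<lambda>_. (\<Sum>n\<in>A. cmod (a n)) powr p"])
    show "AE u in circle_haar. norm (M (Re (\<phi> (of_real (r k) * u)))) \<le> (\<Sum>n\<in>A. cmod (a n)) powr p" for k
      using r[of k] by (intro AE_I2)
        (auto simp: M_def abs_of_nonneg torus_mean_nonneg norm_mult intro!: M_le[unfolded M_def] Re\<phi>_nonneg)
    show "(\<lambda>u. M (Re (\<phi> (of_real (r k) * u)))) \<in> borel_measurable circle_haar" for k
      unfolding \<phi>_def by (intro circle_borel_measurable measurable_compose[OF _ M_meas]) measurable
    show "AE u in circle_haar. (\<lambda>k. M (Re (\<phi> (of_real (r k) * u)))) \<longlonglongrightarrow> M 0"
      using AE_circle_haar_neq[of 1] AE_space
    proof eventually_elim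
      case (elim u)
      have "(\<lambda>k. Re (\<phi> (of_real (r k) * u))) \<longlonglongrightarrow> Re (\<phi> (of_real 1 * u))"
        unfolding \<phi>_def using elim by (intro tendsto_intros r_lim) auto
      moreover have "Re (\<phi> (of_real 1 * u)) = 0"
        using elim by (simp add: Re\<phi>)
      ultimately show ?case
        using elim r by (intro M_lim Re\<phi>_nonneg) (auto simp: norm_mult less_imp_le)
    qed
  qed simp_all
  then have "M \<sigma> \<le> (LINT u|circle_haar. M 0)"
    by (rule LIMSEQ_le_const) (use step in auto)
  also have "\<dots> = M 0" using circle.prob_space by simp
  finally show ?thesis by (simp add: M_def b_def[abs_def])
qed

text \<open>The limit \<open>\<sigma> \<rightarrow> \<infinity>\<close> of the damped sums keeps exactly the terms of weight zero.\<close>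
lemma torus_mean_zero_weight_le:
  assumes p: "0 < p" and A: "finite A" and W: "\<And>n. n \<in> A \<Longrightarrow> 0 \<le> additive_weight lam n + c"
  shows "torus_mean p {n \<in> A. additive_weight lam n + c = 0} a \<le> torus_mean p A a"
proof -
  let ?W = "\<lambda>n. additive_weight lam n + c"
  define b where "b (k::nat) n = a n * exp (- of_real (?W n) * of_real (real (Suc k)))" for k n
  have eq: "b k n = a n * of_real (exp (- ?W n * real (Suc k)))" for k n
    unfolding b_def exp_of_real[symmetric] by simp
  have "(\<lambda>k. torus_mean p A (b k)) \<longlonglongrightarrow> torus_mean p A (\<lambda>n. if ?W n = 0 then a n else 0)"
  proof (rule torus_mean_tendsto[OF p, where B = "\<lambda>n. cmod (a n)"])
    show "cmod (b k n) \<le> cmod (a n)" if "n \<in> A" for k n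
      using W[OF that] by (auto simp: eq norm_mult intro!: mult_left_le mult_nonpos_nonneg)
    show "(\<lambda>k. b k n) \<longlonglongrightarrow> (if ?W n = 0 then a n else 0)" if "n \<in> A" for n
    proof (cases "?W n = 0")
      case False
      then have "0 < ?W n" using W[OF that] by linarith
      then have "(\<lambda>k. exp (- ?W n * real (Suc k))) \<longlonglongrightarrow> 0" 
      proof -
        have "(\<lambda>k. exp (- w * real (Suc k))) \<longlonglongrightarrow> 0" if "0 < w" for w :: real
          using that by real_asymp
        from this[OF \<open>0 < ?W n\<close>] show ?thesis .
      qed
      then have "(\<lambda>k. a n * of_real (exp (- ?W n * real (Suc k)))) \<longlonglongrightarrow> a n * of_real 0"
        by (intro tendsto_intros)
      then show ?thesis using False by (simp add: eq)
    qed (simp add: eq)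
  qed
  moreover have "torus_mean p A (b k) \<le> torus_mean p A a" for k
    unfolding b_def by (rule torus_mean_damped_le[OF p W]) auto
  ultimately have "torus_mean p A (\<lambda>n. if ?W n = 0 then a n else 0) \<le> torus_mean p A a"
    by (intro LIMSEQ_le_const2) auto
  also have "torus_mean p A (\<lambda>n. if ?W n = 0 then a n else 0) = torus_mean p {n \<in> A. ?W n = 0} a"
    using A by (simp add: torus_mean_def if_distrib[of "\<lambda>x. x * _"] sum.inter_filter cong: if_cong)
  finally show ?thesis .
qed

section \<open>Dirichlet polynomials: contraction and coefficient bounds\<close>
lemma prime_nth_prime: "prime (nth_prime j)"
  using enumerate_in_set[OF primes_infinite, of j] by (simp add: nth_prime_def)

lemma bij_nth_prime: "bij_betw nth_prime UNIV {p. prime p}"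
  using bij_enumerate[OF primes_infinite] by (simp add: nth_prime_def[abs_def])

lemma inj_nth_prime: "inj nth_prime"
  using bij_nth_prime by (simp add: bij_betw_def)

lemma bij_nth_prime_divisors:
  assumes "n > 0"
  shows "bij_betw nth_prime {j. nth_prime j dvd n} (prime_factors n)"
proof -
  have "nth_prime ` {j. nth_prime j dvd n} = prime_factors n"
  proof (intro equalityI subsetI)
    fix q assume q: "q \<in> prime_factors n"
    then obtain j where "q = nth_prime j"
      using bij_nth_prime by (auto simp: bij_betw_def)
    then show "q \<in> nth_prime ` {j. nth_prime j dvd n}"
      using q by auto
  qed (use assms prime_nth_prime in \<open>auto intro!: prime_factorsI\<close>)
  then show ?thesis
    using inj_nth_prime by (auto simp: bij_betw_def inj_on_def)
qed

lemma finite_nth_prime_divisors: "n > 0 \<Longrightarrow> finite {j. nth_prime j dvd n}"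
  using bij_betw_finite[OF bij_nth_prime_divisors] by simp

lemma additive_weight_ln:
  assumes "n > 0"
  shows "additive_weight (\<lambda>j. ln (real (nth_prime j))) n = ln (real n)"
proof -
  have "additive_weight (\<lambda>j. ln (real (nth_prime j))) n
      = (\<Sum>q\<in>prime_factors n. ln (real q) * real (multiplicity q n))"
    unfolding additive_weight_def
    by (rule sum.reindex_bij_betw[OF bij_nth_prime_divisors[OF assms]])
  also have "\<dots> = ln (\<Prod>q\<in>prime_factors n. real q ^ multiplicity q n)"
    by (subst ln_prod) (auto simp: ln_realpow prime_factors_gt_0_nat mult.commute)
  also have "(\<Prod>q\<in>prime_factors n. real q ^ multiplicity q n) = real n"
    using arg_cong[OF prime_factorization_nat[OF assms], of real] by simp
  finally show ?thesis .
qed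

lemma additive_weight_single:
  assumes "n > 0"
  shows "additive_weight (\<lambda>i. if i = j then 1 else 0) n = real (multiplicity (nth_prime j) n)"
proof -
  have "additive_weight (\<lambda>i. if i = j then 1 else 0) n
      = (\<Sum>i | nth_prime i dvd n. if i = j then real (multiplicity (nth_prime i) n) else 0)"
    unfolding additive_weight_def by (intro sum.cong) auto
  also have "\<dots> = (if nth_prime j dvd n then real (multiplicity (nth_prime j) n) else 0)"
    using finite_nth_prime_divisors[OF assms] by simp
  finally show ?thesis
    by (simp add: not_dvd_imp_multiplicity_0)
qed

lemma exp_minus_ln_mult: "n > 0 \<Longrightarrow> exp (- of_real (ln (real n)) * s) = (of_nat n :: complex) powr (- s)"
  unfolding powr_def by (simp add: Ln_of_nat mult.commute)

lemma torus_mean_dirichlet_le: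
  assumes p: "0 < p" and A: "0 \<notin> A" and s: "0 < Re s"
  shows "torus_mean p A (\<lambda>n. a n * of_nat n powr (- s)) \<le> torus_mean p A a"
proof -
  let ?W = "additive_weight (\<lambda>j. ln (real (nth_prime j)))"
  have W: "?W n = ln (real n)" if "n \<in> A" for n
    using that A additive_weight_ln by (metis gr0I)
  have *: "a n * of_nat n powr (- s) = a n * exp (- of_real (?W n + 0) * s)" if "n \<in> A" for n s
  proof -
    have "n > 0" using that A by (cases n) auto
    then show ?thesis unfolding W[OF that] add_0_right by (simp only: exp_minus_ln_mult)
  qed
  have "torus_mean p A (\<lambda>n. a n * of_nat n powr (- s)) = torus_mean p A (\<lambda>n. a n * exp (- of_real (?W n + 0) * s))"
    unfolding torus_mean_def using * by (metis (no_types, lifting) sum.cong)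
  also have "\<dots> = torus_mean p A (\<lambda>n. a n * exp (- of_real (?W n + 0) * of_real (Re s)))"
    by (rule torus_mean_vertical_shift)
  also have "\<dots> \<le> torus_mean p A a"
  proof (rule torus_mean_damped_le[OF p _ s])
    fix n assume "n \<in> A"
    then have "n \<ge> 1" using A by (cases n) auto
    then show "0 \<le> ?W n + 0" using W[OF \<open>n \<in> A\<close>] by simp
  qed
  finally show ?thesis .
qed

text \<open>A crude quasi-triangle inequality that covers \<open>p < 1\<close> and \<open>p \<ge> 1\<close> at once.\<close>
lemma add_powr_le:
  fixes x y p :: real
  assumes "0 < p" "0 \<le> x" "0 \<le> y"
  shows "(x + y) powr p \<le> 2 powr p * (x powr p + y powr p)"
proof -
  have "(x + y) powr p \<le> (2 * max x y) powr p"
    using assms by (intro powr_mono2) auto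
  also have "\<dots> = 2 powr p * max x y powr p"
    using assms by (simp add: powr_mult)
  also have "max x y powr p \<le> x powr p + y powr p"
    by (simp add: max_def)
  finally show ?thesis by simp
qed

lemma torus_mean_quasi_triangle:
  assumes p: "0 < p" and eq: "\<And>chi. chi \<in> space torus_haar \<Longrightarrow>
    cmod (\<Sum>n\<in>C. c n * mult_char chi n) \<le> cmod (\<Sum>n\<in>A. a n * mult_char chi n) + cmod (\<Sum>n\<in>B. b n * mult_char chi n)"
  shows "torus_mean p C c \<le> 2 powr p * (torus_mean p A a + torus_mean p B b)"
proof -
  have "torus_mean p C c \<le> (LINT chi|torus_haar. 2 powr p *
      (cmod (\<Sum>n\<in>A. a n * mult_char chi n) powr p + cmod (\<Sum>n\<in>B. b n * mult_char chi n) powr p))"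
    unfolding torus_mean_def
  proof (rule integral_mono)
    fix chi assume "chi \<in> space torus_haar"
    from powr_mono2[OF _ _ eq[OF this], of p]
    show "cmod (\<Sum>n\<in>C. c n * mult_char chi n) powr p \<le> 2 powr p *
      (cmod (\<Sum>n\<in>A. a n * mult_char chi n) powr p + cmod (\<Sum>n\<in>B. b n * mult_char chi n) powr p)"
      using p by (intro order_trans[OF _ add_powr_le]) auto
  qed (use p in \<open>auto intro!: integrable_torus_mean integrable_mult_right Bochner_Integration.integrable_add\<close>)
  also have "\<dots> = 2 powr p * (torus_mean p A a + torus_mean p B b)"
    unfolding torus_mean_def using p by (subst Bochner_Integration.integral_add[symmetric]) (auto intro: integrable_torus_mean)
  finally show ?thesis .
qed

text \<open>Among the terms divisible by \<open>q\<^sup>k\<close>, where \<open>q\<close> is the prime in question, those of exact order \<open>k\<close>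
  have the smaller mean, by \<open>torus_mean_zero_weight_le\<close>. Removing them costs a factor \<open>2 powr (p + 1)\<close>
  and leaves the terms divisible by \<open>q\<^sup>k\<^sup>+\<^sup>1\<close>.\<close>
lemma torus_mean_prime_power_part_le:
  assumes p: "0 < p" and A: "finite A" "0 \<notin> A"
  shows "torus_mean p {n \<in> A. multiplicity (nth_prime j) n = k} a \<le> (2 powr (p + 1)) ^ k * torus_mean p A a"
proof -
  let ?v = "multiplicity (nth_prime j)"
  define U where "U k = {n \<in> A. k \<le> ?v n}" for k
  define S where "S k = {n \<in> A. ?v n = k}" for k
  have W: "additive_weight (\<lambda>i. if i = j then 1 else 0) n = real (?v n)" if "n \<in> A" for n
    using that A additive_weight_single by (metis gr0I)
  have head: "torus_mean p (S k) a \<le> torus_mean p (U k) a" for k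
  proof -
    have "torus_mean p {n \<in> U k. additive_weight (\<lambda>i. if i = j then 1 else 0) n + (- real k) = 0} a \<le> torus_mean p (U k) a"
      by (rule torus_mean_zero_weight_le[OF p]) (auto simp: U_def A W)
    also have "{n \<in> U k. additive_weight (\<lambda>i. if i = j then 1 else 0) n + (- real k) = 0} = S k"
      by (auto simp: U_def S_def W)
    finally show ?thesis .
  qed
  have tail: "torus_mean p (U (Suc k)) a \<le> 2 powr (p + 1) * torus_mean p (U k) a" for k
  proof -
    have UN: "U k = U (Suc k) \<union> S k" "U (Suc k) \<inter> S k = {}" "finite (U (Suc k))" "finite (S k)"
      using A by (auto simp: U_def S_def)
    have "(\<Sum>n\<in>U (Suc k). f n) = (\<Sum>n\<in>U k. f n) - (\<Sum>n\<in>S k. f n)" for f :: "nat \<Rightarrow> complex"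
      unfolding UN(1) by (subst sum.union_disjoint) (use UN in auto)
    then have "torus_mean p (U (Suc k)) a \<le> 2 powr p * (torus_mean p (U k) a + torus_mean p (S k) a)"
      by (intro torus_mean_quasi_triangle[OF p]) (auto intro: norm_triangle_ineq4)
    also have "\<dots> \<le> 2 powr p * (torus_mean p (U k) a + torus_mean p (U k) a)"
      using head[of k] by (intro mult_left_mono) auto
    also have "\<dots> = 2 powr (p + 1) * torus_mean p (U k) a"
      by (simp add: powr_add)
    finally show ?thesis .
  qed
  have "torus_mean p (U k) a \<le> (2 powr (p + 1)) ^ k * torus_mean p A a"
  proof (induction k)
    case 0
    then show ?case by (simp add: U_def)
  next
    case (Suc k)
    have "2 powr (p + 1) * torus_mean p (U k) a \<le> 2 powr (p + 1) * ((2 powr (p + 1)) ^ k * torus_mean p A a)"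
      using Suc.IH by (intro mult_left_mono) auto
    with tail[of k] have "torus_mean p (U (Suc k)) a \<le> \<dots>"
      by (rule order_trans)
    then show ?case by (simp add: mult.assoc)
  qed
  then show ?thesis using head[of k] by (simp add: S_def)
qed

text \<open>The order of every prime is fixed in turn. The factors lost multiply to
  \<open>(2 powr (p + 1)) ^ \<Omega>(n)\<close>, where \<open>\<Omega>(n)\<close> counts prime factors with multiplicity, and \<open>2 ^ \<Omega>(n) \<le> n\<close>.\<close>
lemma norm_coeff_le_torus_mean:
  assumes p: "0 < p" and A: "finite A" "0 \<notin> A" and n: "n \<in> A"
  shows "cmod (a n) powr p \<le> real n powr (p + 1) * torus_mean p A a"
proof -
  define S where "S N = {m \<in> A. \<forall>j<N. multiplicity (nth_prime j) m = multiplicity (nth_prime j) n}" for N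
  define K where "K = 2 powr (p + 1)"
  have K: "0 < K" by (simp add: K_def)
  have n0: "n > 0" using n A by (cases n) auto
  have step: "torus_mean p (S N) a \<le> K ^ (\<Sum>j<N. multiplicity (nth_prime j) n) * torus_mean p A a" for N
  proof (induction N)
    case 0
    then show ?case by (simp add: S_def)
  next
    case (Suc N)
    have "S (Suc N) = {m \<in> S N. multiplicity (nth_prime N) m = multiplicity (nth_prime N) n}"
      by (auto simp: S_def less_Suc_eq)
    then have "torus_mean p (S (Suc N)) a \<le> K ^ multiplicity (nth_prime N) n * torus_mean p (S N) a"
      unfolding K_def using torus_mean_prime_power_part_le[OF p, of "S N"] A by (simp add: S_def)
    also have "\<dots> \<le> K ^ multiplicity (nth_prime N) n * (K ^ (\<Sum>j<N. multiplicity (nth_prime j) n) * torus_mean p A a)"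
      using Suc.IH K by (intro mult_left_mono) auto
    finally show ?case by (simp add: power_add mult_ac)
  qed
  have two: "2 ^ (\<Sum>j<N. multiplicity (nth_prime j) n) \<le> n" for N
  proof -
    have "(\<Prod>j<N. nth_prime j ^ multiplicity (nth_prime j) n) dvd n"
    proof (induction N)
      case (Suc N)
      have "nth_prime i \<noteq> nth_prime N" if "i < N" for i
        using inj_nth_prime that by (auto simp: inj_def)
      then have "coprime (\<Prod>j<N. nth_prime j ^ multiplicity (nth_prime j) n) (nth_prime N ^ multiplicity (nth_prime N) n)"
        using prime_nth_prime by (intro prod_coprime_left) (simp add: primes_coprime)
      then show ?case
        using Suc.IH by (simp add: divides_mult multiplicity_dvd)
    qed simp
    then have "(\<Prod>j<N. nth_prime j ^ multiplicity (nth_prime j) n) \<le> n"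
      using n0 by (rule dvd_imp_le)
    moreover have "2 ^ (\<Sum>j<N. multiplicity (nth_prime j) n) \<le> (\<Prod>j<N. nth_prime j ^ multiplicity (nth_prime j) n)"
      unfolding power_sum using prime_nth_prime by (intro prod_mono) (auto intro!: power_mono prime_ge_2_nat)
    ultimately show ?thesis by linarith
  qed
  have Kn: "K ^ (\<Sum>j<N. multiplicity (nth_prime j) n) \<le> real n powr (p + 1)" for N
  proof -
    have "K ^ (\<Sum>j<N. multiplicity (nth_prime j) n) = real (2 ^ (\<Sum>j<N. multiplicity (nth_prime j) n)) powr (p + 1)"
      unfolding K_def by (simp add: powr_realpow[symmetric] powr_powr mult.commute)
    also have "\<dots> \<le> real n powr (p + 1)"
      using p two[of N] by (intro powr_mono2) (auto simp flip: of_nat_le_iff)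
    finally show ?thesis .
  qed
  \<comment> \<open>Once the orders of all primes that divide some element of \<open>A\<close> are fixed, only \<open>n\<close> is left.\<close>
  obtain N where N: "\<And>m j. m \<in> A \<Longrightarrow> nth_prime j dvd m \<Longrightarrow> j < N"
  proof -
    have "finite (\<Union>m\<in>A. {j. nth_prime j dvd m})"
      using A by (auto intro!: finite_nth_prime_divisors intro: gr0I)
    then obtain N where "\<forall>j\<in>(\<Union>m\<in>A. {j. nth_prime j dvd m}). j < N"
      using finite_nat_set_iff_bounded by blast
    then show ?thesis using that by auto
  qed
  have "m = n" if "m \<in> S N" for m
  proof (rule multiplicity_eq_nat)
    have m: "m \<in> A" "\<And>j. j < N \<Longrightarrow> multiplicity (nth_prime j) m = multiplicity (nth_prime j) n"
      using that by (auto simp: S_def)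
    show "m > 0" using m(1) A by (cases m) auto
    show "n > 0" by fact
    fix q :: nat assume "prime q"
    then obtain j where j: "q = nth_prime j" using bij_nth_prime by (auto simp: bij_betw_def)
    show "multiplicity q m = multiplicity q n"
    proof (cases "j < N")
      case False
      then have "\<not> nth_prime j dvd m" "\<not> nth_prime j dvd n"
        using N m(1) n by blast+
      then show ?thesis by (simp add: j not_dvd_imp_multiplicity_0)
    qed (simp add: j m)
  qed
  then have "S N = {n}" using n by (auto simp: S_def)
  moreover have "torus_mean p {n} a = cmod (a n) powr p"
  proof -
    have "torus_mean p {n} a = (LINT chi|torus_haar. cmod (a n) powr p)"
      unfolding torus_mean_def by (intro Bochner_Integration.integral_cong) (auto simp: norm_mult norm_mult_char)
    then show ?thesis by (simp add: torus_haar.prob_space)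
  qed
  ultimately show ?thesis
    using step[of N] mult_right_mono[OF Kn[of N] torus_mean_nonneg[of p A a]] by simp
qed

section \<open>Almost sure convergence of vertical limits\<close>
definition dpoly :: "(nat \<Rightarrow> complex) \<Rightarrow> (nat \<Rightarrow> complex) \<Rightarrow> complex \<Rightarrow> complex" where
  "dpoly P chi s = (\<Sum>n | P n \<noteq> 0. P n * mult_char chi n * of_nat n powr (- s))"

lemma dpoly_superset:
  assumes "finite A" "{n. P n \<noteq> 0} \<subseteq> A"
  shows "dpoly P chi s = (\<Sum>n\<in>A. P n * of_nat n powr (- s) * mult_char chi n)"
  unfolding dpoly_def using assms by (intro sum.mono_neutral_cong_left) auto

lemma dirichlet_polys_diff:
  assumes "P \<in> dirichlet_polys" "Q \<in> dirichlet_polys"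
  shows "(\<lambda>n. P n - Q n) \<in> dirichlet_polys"
proof -
  have "{n. P n - Q n \<noteq> 0} \<subseteq> {n. P n \<noteq> 0} \<union> {n. Q n \<noteq> 0}" by auto
  then show ?thesis
    using assms finite_subset by (auto simp: dirichlet_polys_def)
qed

lemma dpoly_diff:
  assumes "P \<in> dirichlet_polys" "Q \<in> dirichlet_polys"
  shows "dpoly (\<lambda>n. P n - Q n) chi s = dpoly P chi s - dpoly Q chi s"
proof -
  let ?A = "{n. P n \<noteq> 0} \<union> {n. Q n \<noteq> 0}"
  have fin: "finite ?A" using assms by (auto simp: dirichlet_polys_def)
  have "{n. P n - Q n \<noteq> 0} \<subseteq> ?A" by auto
  then show ?thesis
    using fin by (simp add: dpoly_superset[of ?A] sum_subtractf algebra_simps)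
qed

lemma dpoly_holomorphic:
  assumes "P \<in> dirichlet_polys"
  shows "dpoly P chi holomorphic_on S"
proof -
  have "dpoly P chi = (\<lambda>s. \<Sum>n | P n \<noteq> 0. P n * mult_char chi n * exp (- s * Ln (of_nat n)))"
    using assms unfolding dpoly_def
    by (intro ext sum.cong) (auto simp: powr_def dirichlet_polys_def)
  then show ?thesis
    by (simp only:) (intro holomorphic_intros)
qed

lemma dpoly_measurable [measurable]: "(\<lambda>chi. dpoly P chi s) \<in> borel_measurable torus_haar"
  unfolding dpoly_def by measurable

lemma poly_norm_nonneg: "0 \<le> poly_norm p P"
  by (simp add: poly_norm_def)

lemma poly_norm_powr:
  assumes "0 < p"
  shows "poly_norm p P powr p = torus_mean p {n. P n \<noteq> 0} P"
  using assms torus_mean_nonneg[of p "{n. P n \<noteq> 0}" P]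
  by (simp add: poly_norm_def torus_mean_def powr_powr)

lemma norm_coeff_le_poly_norm:
  assumes p: "0 < p" and P: "P \<in> dirichlet_polys"
  shows "cmod (P n) \<le> real n powr ((p + 1) / p) * poly_norm p P"
proof (cases "P n = 0")
  case False
  then have "cmod (P n) powr p \<le> real n powr (p + 1) * poly_norm p P powr p"
    unfolding poly_norm_powr[OF p] using P by (intro norm_coeff_le_torus_mean[OF p]) (auto simp: dirichlet_polys_def)
  then have "(cmod (P n) powr p) powr (1 / p) \<le> (real n powr (p + 1) * poly_norm p P powr p) powr (1 / p)"
    using p by (intro powr_mono2) auto
  then show ?thesis
    using p by (simp add: powr_mult powr_powr poly_norm_nonneg)
qed (simp add: poly_norm_nonneg)

lemma dpoly_mean_le:
  assumes p: "0 < p" and P: "P \<in> dirichlet_polys" and s: "0 < Re s"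
  shows "integrable torus_haar (\<lambda>chi. cmod (dpoly P chi s) powr p)"
    and "(LINT chi|torus_haar. cmod (dpoly P chi s) powr p) \<le> poly_norm p P powr p"
proof -
  have eq: "dpoly P chi s = (\<Sum>n | P n \<noteq> 0. P n * of_nat n powr (- s) * mult_char chi n)" for chi
    using P by (intro dpoly_superset) (auto simp: dirichlet_polys_def)
  show "integrable torus_haar (\<lambda>chi. cmod (dpoly P chi s) powr p)"
    unfolding eq by (rule integrable_torus_mean[OF p])
  have "0 \<notin> {n. P n \<noteq> 0}" using P by (auto simp: dirichlet_polys_def)
  from torus_mean_dirichlet_le[OF p this s, of P]
  show "(LINT chi|torus_haar. cmod (dpoly P chi s) powr p) \<le> poly_norm p P powr p"
    unfolding eq poly_norm_powr[OF p] by (simp add: torus_mean_def)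
qed

text \<open>The circle means bound the polynomial uniformly on a smaller disc, and their expectation
  is controlled by the norm.\<close>
lemma dpoly_circle_mean:
  fixes z0 :: complex and r :: real
  assumes p: "0 < p" and P: "P \<in> dirichlet_polys" and r: "0 < r" "r < Re z0"
  defines "X \<equiv> \<lambda>chi. LINT u|circle_haar. cmod (dpoly P chi (z0 + of_real r * u)) powr p"
  shows "integrable torus_haar X" "(LINT chi|torus_haar. X chi) \<le> poly_norm p P powr p"
    and "\<And>chi s. cmod (s - z0) \<le> r / 2 \<Longrightarrow> cmod (dpoly P chi s) powr p \<le> 2 * X chi"
proof -
  define f where "f = (\<lambda>(chi, u). cmod (dpoly P chi (z0 + of_real r * u)) powr p)"
  interpret T: pair_prob_space torus_haar circle_haar ..
  have [measurable]: "(\<lambda>u. u) \<in> borel_measurable circle_haar"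
    by (rule circle_borel_measurable) simp
  have f_meas: "f \<in> borel_measurable (torus_haar \<Otimes>\<^sub>M circle_haar)"
    unfolding f_def dpoly_def powr_def[where 'a = complex] by measurable
  have Re_pos: "0 < Re (z0 + of_real r * u)" if "cmod u = 1" for u
  proof -
    have "- Re u \<le> 1" using that abs_Re_le_cmod[of u] by linarith
    then have "r * (- Re u) \<le> r * 1" using r by (intro mult_left_mono) auto
    then show ?thesis using r by simp
  qed
  have f_int: "integrable (torus_haar \<Otimes>\<^sub>M circle_haar) f"
  proof (rule T.integrable_const_bound[OF _ f_meas, where B = "(\<Sum>n | P n \<noteq> 0. cmod (P n)) powr p"])
    have bd: "cmod (dpoly P chi s) \<le> (\<Sum>n | P n \<noteq> 0. cmod (P n))" if "chi \<in> space torus_haar" "0 < Re s" for chi s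
      unfolding dpoly_def
    proof (intro order_trans[OF norm_sum] sum_mono)
      fix n assume "n \<in> {n. P n \<noteq> 0}"
      then have n: "1 \<le> n" using P by (cases n) (auto simp: dirichlet_polys_def)
      then have "real n powr (- Re s) \<le> 1"
        using that(2) powr_mono[of "- Re s" 0 "real n"] by simp
      then show "cmod (P n * mult_char chi n * of_nat n powr (- s)) \<le> cmod (P n)"
        using n that(1) norm_powr_real_powr[of "of_nat n" "- s"]
        by (simp add: norm_mult norm_mult_char mult_left_le)
    qed
    show "AE x in torus_haar \<Otimes>\<^sub>M circle_haar. norm (f x) \<le> (\<Sum>n | P n \<noteq> 0. cmod (P n)) powr p"
      using p Re_pos by (intro AE_I2) (auto simp: f_def space_pair_measure intro!: powr_mono2 bd)
  qed
  show "integrable torus_haar X"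
    using T.integrable_fst'[OF f_int] by (simp add: f_def X_def)
  have "(LINT chi|torus_haar. X chi) = (LINT u|circle_haar. LINT chi|torus_haar. f (chi, u))"
    using T.Fubini_integral[of "\<lambda>chi u. f (chi, u)"] f_int by (simp add: f_def X_def)
  also have "\<dots> \<le> poly_norm p P powr p"
  proof (rule circle.integral_le_const)
    show "integrable circle_haar (\<lambda>u. LINT chi|torus_haar. f (chi, u))"
      using T.integrable_snd[of "\<lambda>chi u. f (chi, u)"] f_int by simp
    show "AE u in circle_haar. (LINT chi|torus_haar. f (chi, u)) \<le> poly_norm p P powr p"
      by (intro AE_I2) (auto simp: f_def intro!: dpoly_mean_le(2)[OF p P] Re_pos)
  qed
  finally show "(LINT chi|torus_haar. X chi) \<le> poly_norm p P powr p" .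
  fix chi s assume s: "cmod (s - z0) \<le> r / 2"
  define w where "w = (s - z0) / of_real r"
  have w: "cmod w \<le> 1 / 2" using s r by (simp add: w_def norm_divide field_simps)
  have "(\<lambda>w. dpoly P chi (z0 + of_real r * w)) holomorphic_on ball 0 2"
  proof -
    have "(\<lambda>w. z0 + of_real r * w) holomorphic_on ball 0 2"
      by (intro holomorphic_intros)
    from holomorphic_on_compose_gen[OF this dpoly_holomorphic[OF P, of chi UNIV]] show ?thesis
      by (simp add: o_def)
  qed
  then have "cmod (dpoly P chi (z0 + of_real r * w)) powr p \<le> 1 / (1 - cmod w) * X chi"
    unfolding X_def using w by (intro holomorphic_powr_le_circle_mean[OF p]) auto
  also have "\<dots> \<le> 2 * X chi"
    unfolding X_def using w by (intro mult_right_mono) (auto simp: field_simps)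
  finally show "cmod (dpoly P chi s) powr p \<le> 2 * X chi"
    using r by (simp add: w_def)
qed

lemma open_halfplane: "open (halfplane \<theta>)"
  unfolding halfplane_def by (rule open_halfspace_Re_gt)

lemma connected_halfplane: "connected (halfplane \<theta>)"
  unfolding halfplane_def by (intro convex_connected convex_halfspace_Re_gt)

lemma vertical_limit_eq:
  assumes g: "extends_vertical_limit a chi g" and s: "s \<in> halfplane 0"
  shows "vertical_limit a chi s = g s"
proof -
  define h where "h = (SOME g. extends_vertical_limit a chi g)"
  have h: "extends_vertical_limit a chi h"
    unfolding h_def by (rule someI[of "extends_vertical_limit a chi", OF g])
  obtain \<theta> \<theta>' where \<theta>: "\<theta> \<ge> 0" "\<And>s. s \<in> halfplane \<theta> \<Longrightarrow> (\<lambda>n. a n * mult_char chi n * of_nat n powr (- s)) sums g s"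
    and \<theta>': "\<theta>' \<ge> 0" "\<And>s. s \<in> halfplane \<theta>' \<Longrightarrow> (\<lambda>n. a n * mult_char chi n * of_nat n powr (- s)) sums h s"
    using g h unfolding extends_vertical_limit_def by blast
  have "g s = h s"
  proof (rule analytic_continuation_open[where f = g and g = h, OF open_halfplane[of "max \<theta> \<theta>'"] open_halfplane[of 0] _ connected_halfplane])
    have "of_real (max \<theta> \<theta>' + 1) \<in> halfplane (max \<theta> \<theta>')"
      by (simp add: halfplane_def less_add_one max_def)
    then show "halfplane (max \<theta> \<theta>') \<noteq> {}" by blast
    show "halfplane (max \<theta> \<theta>') \<subseteq> halfplane 0"
      using \<theta> by (auto simp: halfplane_def)
    show "g z = h z" if "z \<in> halfplane (max \<theta> \<theta>')" for z
      using that \<theta>(2)[of z] \<theta>'(2)[of z] by (auto simp: halfplane_def intro: sums_unique2)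
  qed (use g h s in \<open>auto simp: extends_vertical_limit_def\<close>)
  then show ?thesis
    using g by (auto simp: vertical_limit_def h_def)
qed

lemma vertical_limit_measurable:
  "vertical_limit a chi \<in> borel_measurable (restrict_space borel (halfplane 0))"
proof (cases "\<exists>g. extends_vertical_limit a chi g")
  case True
  have hol: "g holomorphic_on halfplane 0" if "extends_vertical_limit a chi g" for g
    using that by (simp add: extends_vertical_limit_def)
  have "vertical_limit a chi holomorphic_on halfplane 0"
    unfolding vertical_limit_def if_P[OF True] by (rule hol[OF someI_ex[OF True]])
  then show ?thesis
    by (intro borel_measurable_continuous_on_restrict holomorphic_on_imp_continuous_on)
next
  case False
  then show ?thesis by (simp add: vertical_limit_def)
qed

text \<open>The coefficient bound turns convergence in norm into absolute convergence of the series far to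
  the right, uniformly in the character.\<close>
lemma dpoly_tendsto_series:
  assumes p: "0 < p" and P: "Hp_approx p a P" and chi: "chi \<in> space torus_haar"
    and s: "(p + 1) / p + 1 < Re s"
  shows "(\<lambda>n. a n * mult_char chi n * of_nat n powr (- s)) sums (\<Sum>n. a n * mult_char chi n * of_nat n powr (- s))"
    and "(\<lambda>j. dpoly (P j) chi s) \<longlonglongrightarrow> (\<Sum>n. a n * mult_char chi n * of_nat n powr (- s))"
proof -
  define e where "e = (p + 1) / p"
  define c where "c n = mult_char chi n * of_nat n powr (- s)" for n :: nat
  have c: "cmod (c n) = real n powr (- Re s)" for n
    using norm_powr_real_powr[of "of_nat n" "- s"] chi
    by (cases "n = 0") (auto simp: c_def norm_mult norm_mult_char)
  define S where "S = (\<Sum>n. real n powr (e - Re s))"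
  have S: "summable (\<lambda>n. real n powr (e - Re s))"
    using s by (simp add: summable_real_powr_iff e_def)
  have S0: "0 \<le> S" unfolding S_def by (rule suminf_nonneg[OF S]) simp
  have poly: "P j \<in> dirichlet_polys" for j
    using P by (simp add: Hp_approx_def)
  have bound: "\<exists>K. \<forall>j\<ge>K. \<forall>n. cmod ((P j n - a n) * c n) \<le> \<epsilon> * real n powr (e - Re s)" if eps: "\<epsilon> > 0" for \<epsilon>
  proof -
    obtain K where "\<forall>j\<ge>K. \<forall>k\<ge>K. poly_norm p (\<lambda>n. P j n - P k n) < \<epsilon>"
      using P eps unfolding Hp_approx_def by blast
    then have K: "poly_norm p (\<lambda>n. P j n - P k n) < \<epsilon>" if "j \<ge> K" "k \<ge> K" for j k
      using that by blast
    have "cmod ((P j n - a n) * c n) \<le> \<epsilon> * real n powr (e - Re s)" if j: "j \<ge> K" for j n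
    proof -
      have "cmod (P j n - P k n) \<le> real n powr e * \<epsilon>" if "k \<ge> K" for k
      proof -
        have "cmod (P j n - P k n) \<le> real n powr e * poly_norm p (\<lambda>n. P j n - P k n)"
          unfolding e_def by (rule norm_coeff_le_poly_norm[OF p dirichlet_polys_diff[OF poly poly]])
        also have "\<dots> \<le> real n powr e * \<epsilon>"
          using K[OF j that] by (intro mult_left_mono) auto
        finally show ?thesis .
      qed
      moreover have "(\<lambda>k. cmod (P j n - P k n)) \<longlonglongrightarrow> cmod (P j n - a n)"
        using P by (intro tendsto_intros) (auto simp: Hp_approx_def)
      ultimately have "cmod (P j n - a n) \<le> real n powr e * \<epsilon>"
        by (intro LIMSEQ_le_const2) auto
      then have "cmod (P j n - a n) * cmod (c n) \<le> (real n powr e * \<epsilon>) * real n powr (- Re s)"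
        unfolding c by (rule mult_right_mono) simp
      then show ?thesis
        by (simp add: norm_mult powr_diff powr_minus divide_inverse mult_ac)
    qed
    then show ?thesis by blast
  qed
  have sP: "summable (\<lambda>n. P j n * c n)" for j
    using poly[of j] by (intro summable_finite[of "{n. P j n \<noteq> 0}"]) (auto simp: dirichlet_polys_def)
  have dP: "dpoly (P j) chi s = (\<Sum>n. P j n * c n)" for j
    unfolding dpoly_def using poly[of j]
    by (subst suminf_finite[of "{n. P j n \<noteq> 0}"]) (auto simp: dirichlet_polys_def c_def mult_ac)
  have summ: "summable (\<lambda>n. a n * c n)"
  proof -
    obtain K where K: "\<And>n. cmod ((P K n - a n) * c n) \<le> 1 * real n powr (e - Re s)"
      using bound[of 1] by auto
    have "summable (\<lambda>n. (P K n - a n) * c n)"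
      by (rule summable_comparison_test'[OF S]) (use K in auto)
    from summable_diff[OF sP[of K] this] show ?thesis by (simp add: algebra_simps)
  qed
  then show "(\<lambda>n. a n * mult_char chi n * of_nat n powr (- s)) sums (\<Sum>n. a n * mult_char chi n * of_nat n powr (- s))"
    by (simp add: c_def summable_sums mult.assoc)
  have "(\<lambda>j. dpoly (P j) chi s) \<longlonglongrightarrow> (\<Sum>n. a n * c n)"
  proof (rule LIMSEQ_I)
    fix r :: real assume "0 < r"
    define \<epsilon> where "\<epsilon> = r / (S + 1)"
    have \<epsilon>: "\<epsilon> > 0" "\<epsilon> * S < r"
      using \<open>0 < r\<close> S0 by (auto simp: \<epsilon>_def field_simps)
    obtain K where K: "\<And>j n. j \<ge> K \<Longrightarrow> cmod ((P j n - a n) * c n) \<le> \<epsilon> * real n powr (e - Re s)"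
      using bound[OF \<epsilon>(1)] by blast
    have "norm (dpoly (P j) chi s - (\<Sum>n. a n * c n)) < r" if "j \<ge> K" for j
    proof -
      have "dpoly (P j) chi s - (\<Sum>n. a n * c n) = (\<Sum>n. (P j n - a n) * c n)"
        unfolding dP by (subst suminf_diff[OF sP summ]) (simp add: algebra_simps)
      also have "norm \<dots> \<le> (\<Sum>n. \<epsilon> * real n powr (e - Re s))"
        using K[OF that] S by (intro norm_suminf_le summable_mult)
      also have "\<dots> = \<epsilon> * S" unfolding S_def using S by (rule suminf_mult)
      finally show ?thesis using \<epsilon>(2) by simp
    qed
    then show "\<exists>K. \<forall>j\<ge>K. norm (dpoly (P j) chi s - (\<Sum>n. a n * c n)) < r" by blast
  qed
  then show "(\<lambda>j. dpoly (P j) chi s) \<longlonglongrightarrow> (\<Sum>n. a n * mult_char chi n * of_nat n powr (- s))"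
    by (simp add: c_def mult.assoc)
qed

text \<open>A Borel--Cantelli argument: increments of norm \<open>4\<^sup>-\<^sup>j\<close> have circle means whose expectations,
  multiplied by \<open>2\<^sup>j\<^sup>p\<close>, are still summable.\<close>
lemma AE_dpoly_increments_small:
  assumes p: "0 < p" and P: "\<And>j. P j \<in> dirichlet_polys" and fast: "\<And>j. poly_norm p (\<lambda>n. P (Suc j) n - P j n) \<le> (1 / 4) ^ j"
    and z0: "0 < Re z0"
  shows "AE chi in torus_haar. \<exists>C. \<forall>j. \<forall>s\<in>cball z0 (Re z0 / 4). cmod (dpoly (P (Suc j)) chi s - dpoly (P j) chi s) \<le> C * (1 / 2) ^ j"
proof -
  define r where "r = Re z0 / 2"
  have r: "0 < r" "r < Re z0" using z0 by (auto simp: r_def)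
  define D where "D j = (\<lambda>n. P (Suc j) n - P j n)" for j
  have D: "D j \<in> dirichlet_polys" for j
    unfolding D_def by (intro dirichlet_polys_diff P)
  define X where "X j chi = (LINT u|circle_haar. cmod (dpoly (D j) chi (z0 + of_real r * u)) powr p)" for j chi
  note X = dpoly_circle_mean[OF p D r, folded X_def]
  have X_nonneg: "0 \<le> X j chi" for j chi
    by (simp add: X_def)
  have [measurable]: "X j \<in> borel_measurable torus_haar" for j
    using X(1) by (rule borel_measurable_integrable)
  \<comment> \<open>The expectations are at most \<open>(q ^ j)\<^sup>2\<close>; half of this decay makes the sum finite and the other
    half is kept as the almost sure rate.\<close>
  define q where "q = (1 / 2 :: real) powr p"
  have q: "0 < q" "q < 1"
    using p powr_less_mono2[of p "1 / 2" 1] by (auto simp: q_def)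
  have EX: "(\<integral>\<^sup>+ chi. ennreal (X j chi) \<partial>torus_haar) \<le> ennreal ((q ^ j)\<^sup>2)" for j
  proof -
    have "(\<integral>\<^sup>+ chi. ennreal (X j chi) \<partial>torus_haar) = ennreal (LINT chi|torus_haar. X j chi)"
      by (rule nn_integral_eq_integral[OF X(1)]) (simp add: X_nonneg)
    also have "(LINT chi|torus_haar. X j chi) \<le> poly_norm p (D j) powr p"
      by (rule X(2))
    also have "\<dots> \<le> ((1 / 4) ^ j) powr p"
      using p fast[of j] by (intro powr_mono2) (auto simp: D_def poly_norm_nonneg)
    also have "\<dots> = (q ^ j)\<^sup>2"
    proof -
      have "((1 / 4 :: real) ^ j) = (((1 / 2) ^ j)\<^sup>2)"
        by (simp add: power2_eq_square power_mult_distrib[symmetric])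
      also have "\<dots> powr p = (((1 / 2) ^ j) powr p)\<^sup>2"
        by (simp add: power2_eq_square powr_mult)
      also have "((1 / 2 :: real) ^ j) powr p = q ^ j"
        unfolding q_def by (simp add: powr_power powr_realpow[symmetric] powr_powr mult.commute)
      finally show ?thesis .
    qed
    finally show ?thesis by (simp add: ennreal_leI)
  qed
  have "(\<integral>\<^sup>+ chi. (\<Sum>j. ennreal (X j chi / q ^ j)) \<partial>torus_haar) = (\<Sum>j. \<integral>\<^sup>+ chi. ennreal (X j chi / q ^ j) \<partial>torus_haar)"
    by (rule nn_integral_suminf) measurable
  also have "\<dots> \<le> (\<Sum>j. ennreal (q ^ j))"
  proof (intro suminf_le allI)
    fix j
    have "(\<integral>\<^sup>+ chi. ennreal (X j chi / q ^ j) \<partial>torus_haar) = ennreal (1 / q ^ j) * (\<integral>\<^sup>+ chi. ennreal (X j chi) \<partial>torus_haar)"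
      using q by (subst nn_integral_cmult[symmetric]) (auto simp: ennreal_mult''[symmetric] X_nonneg)
    also have "\<dots> \<le> ennreal (1 / q ^ j) * ennreal ((q ^ j)\<^sup>2)"
      by (intro mult_left_mono EX) auto
    also have "\<dots> = ennreal (q ^ j)"
      using q by (subst ennreal_mult''[symmetric]) (auto simp: power2_eq_square)
    finally show "(\<integral>\<^sup>+ chi. ennreal (X j chi / q ^ j) \<partial>torus_haar) \<le> ennreal (q ^ j)" .
  qed auto
  also have "\<dots> = ennreal (\<Sum>j. q ^ j)"
    using q by (intro suminf_ennreal2) (auto intro: summable_geometric)
  finally have "(\<integral>\<^sup>+ chi. (\<Sum>j. ennreal (X j chi / q ^ j)) \<partial>torus_haar) \<noteq> \<infinity>"
    by (auto simp: top_unique)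
  then have "AE chi in torus_haar. (\<Sum>j. ennreal (X j chi / q ^ j)) \<noteq> \<infinity>"
    by (intro nn_integral_PInf_AE) measurable
  then show ?thesis
  proof (rule eventually_mono)
    fix chi assume fin: "(\<Sum>j. ennreal (X j chi / q ^ j)) \<noteq> \<infinity>"
    define C where "C = enn2real (\<Sum>j. ennreal (X j chi / q ^ j))"
    have C: "X j chi \<le> C * q ^ j" for j
    proof -
      have "ennreal (X j chi / q ^ j) \<le> (\<Sum>j. ennreal (X j chi / q ^ j))"
        using sum_le_suminf[of "\<lambda>j. ennreal (X j chi / q ^ j)" "{j}"] by simp
      also have "\<dots> = ennreal C" using fin by (simp add: C_def top.not_eq_extremum)
      finally have "X j chi / q ^ j \<le> C"
        by (simp add: C_def)
      then show ?thesis using q by (simp add: field_simps)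
    qed
    show "\<exists>C. \<forall>j. \<forall>s\<in>cball z0 (Re z0 / 4). cmod (dpoly (P (Suc j)) chi s - dpoly (P j) chi s) \<le> C * (1 / 2) ^ j"
    proof (intro exI[of _ "(2 * C) powr (1 / p)"] allI ballI)
      fix j s assume s: "s \<in> cball z0 (Re z0 / 4)"
      have "cmod (dpoly (D j) chi s) powr p \<le> 2 * X j chi"
        using s by (intro X(3)) (auto simp: r_def dist_norm norm_minus_commute)
      also have "\<dots> \<le> (2 * C) * q ^ j" using C[of j] by simp
      finally have "(cmod (dpoly (D j) chi s) powr p) powr (1 / p) \<le> ((2 * C) * q ^ j) powr (1 / p)"
        using p by (intro powr_mono2) auto
      also have "\<dots> = (2 * C) powr (1 / p) * (q ^ j) powr (1 / p)"
        by (rule powr_mult)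
      also have "(q ^ j) powr (1 / p) = (1 / 2) ^ j"
        unfolding q_def using p by (simp add: powr_realpow[symmetric] powr_powr powr_power mult_ac)
      finally show "cmod (dpoly (P (Suc j)) chi s - dpoly (P j) chi s) \<le> (2 * C) powr (1 / p) * (1 / 2) ^ j"
        using p by (simp add: powr_powr D_def dpoly_diff[OF P P])
    qed
  qed
qed

text \<open>Countably many discs suffice, so that the exceptional null sets may be united.\<close>
lemma countable_cover_halfplane:
  obtains Z where "countable Z" "\<And>z. z \<in> Z \<Longrightarrow> 0 < Re z"
    "\<And>s. s \<in> halfplane 0 \<Longrightarrow> \<exists>z\<in>Z. s \<in> ball z (Re z / 4)"
proof -
  obtain D :: "complex set" where D: "countable D" "\<And>X. open X \<Longrightarrow> X \<noteq> {} \<Longrightarrow> \<exists>d\<in>D. d \<in> X"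
    using countable_dense_exists[where 'a = complex] by auto
  show thesis
  proof
    show "countable {z\<in>D. 0 < Re z}" using D(1) by simp
    fix s assume s: "s \<in> halfplane 0"
    then have "ball s (Re s / 8) \<noteq> {}" by (simp add: halfplane_def)
    then obtain z where z: "z \<in> D" "z \<in> ball s (Re s / 8)"
      using D(2)[of "ball s (Re s / 8)"] by auto
    then have "\<bar>Re (s - z)\<bar> < Re s / 8"
      using abs_Re_le_cmod[of "s - z"] by (simp add: dist_norm)
    moreover have "0 < Re s"
      using s by (simp add: halfplane_def)
    ultimately have "Re s / 8 < Re z / 4" "0 < Re z"
      unfolding minus_complex.simps by linarith+
    then show "\<exists>z\<in>{z\<in>D. 0 < Re z}. s \<in> ball z (Re z / 4)"
      using z by (intro bexI[of _ z]) (auto simp: dist_commute)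
  qed simp
qed

lemma AE_vertical_limit_of_fast_approx:
  assumes p: "0 < p" and P: "Hp_approx p a P" and fast: "\<And>j. poly_norm p (\<lambda>n. P (Suc j) n - P j n) \<le> (1 / 4) ^ j"
  shows "AE chi in torus_haar. \<forall>s\<in>halfplane 0. (\<lambda>j. dpoly (P j) chi s) \<longlonglongrightarrow> vertical_limit a chi s"
proof -
  obtain Z where Z: "countable Z" "\<And>z. z \<in> Z \<Longrightarrow> 0 < Re z"
    "\<And>s. s \<in> halfplane 0 \<Longrightarrow> \<exists>z\<in>Z. s \<in> ball z (Re z / 4)"
    using countable_cover_halfplane by blast
  have poly: "P j \<in> dirichlet_polys" for j
    using P by (simp add: Hp_approx_def)
  have "AE chi in torus_haar. \<forall>z0\<in>Z. \<exists>C. \<forall>j. \<forall>s\<in>cball z0 (Re z0 / 4).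
      cmod (dpoly (P (Suc j)) chi s - dpoly (P j) chi s) \<le> C * (1 / 2) ^ j"
    using Z(1,2) by (subst AE_ball_countable) (auto intro!: AE_dpoly_increments_small[OF p poly fast])
  then show ?thesis
    using AE_space
  proof eventually_elim
    case (elim chi)
    define d where "d j s = dpoly (P (Suc j)) chi s - dpoly (P j) chi s" for j s
    define g where "g s = dpoly (P 0) chi s + (\<Sum>j. d j s)" for s
    have tele: "dpoly (P j) chi s = dpoly (P 0) chi s + (\<Sum>i<j. d i s)" for j s
      using sum_lessThan_telescope[of "\<lambda>j. dpoly (P j) chi s" j] by (simp add: d_def)
    have unif: "\<exists>z. s \<in> ball z (Re z / 4) \<and> uniform_limit (cball z (Re z / 4)) (\<lambda>j. dpoly (P j) chi) g sequentially"
      if s: "s \<in> halfplane 0" for s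
    proof -
      obtain z where z: "z \<in> Z" "s \<in> ball z (Re z / 4)"
        using Z(3)[OF s] by blast
      obtain C where C: "\<And>j s. s \<in> cball z (Re z / 4) \<Longrightarrow> cmod (d j s) \<le> C * (1 / 2) ^ j"
        using elim(1) z(1) unfolding d_def by blast
      have "uniform_limit (cball z (Re z / 4)) (\<lambda>j s. \<Sum>i<j. d i s) (\<lambda>s. \<Sum>i. d i s) sequentially"
        by (rule Weierstrass_m_test[where M = "\<lambda>j. C * (1 / 2) ^ j"]) (auto intro: C summable_mult)
      then have "uniform_limit (cball z (Re z / 4)) (\<lambda>j s. dpoly (P 0) chi s + (\<Sum>i<j. d i s)) (\<lambda>s. dpoly (P 0) chi s + (\<Sum>i. d i s)) sequentially"
        by (intro uniform_limit_intros)
      then show ?thesis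
        using z(2) by (auto simp: tele[symmetric] g_def[abs_def])
    qed
    have lim: "(\<lambda>j. dpoly (P j) chi s) \<longlonglongrightarrow> g s" if "s \<in> halfplane 0" for s
      using unif[OF that] by (auto intro: tendsto_uniform_limitI)
    have hol: "g holomorphic_on halfplane 0"
    proof (rule holomorphic_uniform_sequence[OF open_halfplane dpoly_holomorphic[OF poly]])
      fix s assume s: "s \<in> halfplane 0"
      obtain z where z: "s \<in> ball z (Re z / 4)" "uniform_limit (cball z (Re z / 4)) (\<lambda>j. dpoly (P j) chi) g sequentially"
        using unif[OF s] by blast
      have "open (ball z (Re z / 4) \<inter> halfplane 0)"
        by (intro open_Int open_ball open_halfplane)
      then obtain e where e: "e > 0" "cball s e \<subseteq> ball z (Re z / 4) \<inter> halfplane 0"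
        using z(1) s open_contains_cball by (metis IntI)
      have "cball s e \<subseteq> cball z (Re z / 4)"
        using e(2) ball_subset_cball by blast
      then show "\<exists>e>0. cball s e \<subseteq> halfplane 0 \<and> uniform_limit (cball s e) (\<lambda>j. dpoly (P j) chi) g sequentially"
        using e uniform_limit_on_subset[OF z(2)] by blast
    qed
    have "extends_vertical_limit a chi g"
      unfolding extends_vertical_limit_def
    proof (intro conjI hol exI[of _ "(p + 1) / p + 1"] ballI)
      show "0 \<le> (p + 1) / p + 1" using p by simp
      fix s assume "s \<in> halfplane ((p + 1) / p + 1)"
      then have s: "(p + 1) / p + 1 < Re s" by (simp add: halfplane_def)
      moreover have "0 \<le> (p + 1) / p" using p by simp
      ultimately have "s \<in> halfplane 0"
        unfolding halfplane_def mem_Collect_eq by linarith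
      from LIMSEQ_unique[OF lim[OF this] dpoly_tendsto_series(2)[OF p P elim(2) s]]
      show "(\<lambda>n. a n * mult_char chi n * of_nat n powr (- s)) sums g s"
        using dpoly_tendsto_series(1)[OF p P elim(2) s] by simp
    qed
    then show ?case
      using lim by (simp add: vertical_limit_eq)
  qed
qed

lemma Hp_approx_subseq:
  assumes "Hp_approx p a P" "strict_mono r"
  shows "Hp_approx p a (P \<circ> r)"
  unfolding Hp_approx_def
proof (intro conjI allI impI)
  show "(P \<circ> r) k \<in> dirichlet_polys" for k
    using assms by (simp add: Hp_approx_def)
  fix \<epsilon> :: real assume "0 < \<epsilon>"
  then obtain K where "\<forall>j\<ge>K. \<forall>k\<ge>K. poly_norm p (\<lambda>n. P j n - P k n) < \<epsilon>"
    using assms(1) unfolding Hp_approx_def by blast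
  then show "\<exists>K. \<forall>j\<ge>K. \<forall>k\<ge>K. poly_norm p (\<lambda>n. (P \<circ> r) j n - (P \<circ> r) k n) < \<epsilon>"
    using seq_suble[OF assms(2)] order_trans unfolding o_def by blast
next
  show "(\<lambda>k. (P \<circ> r) k n) \<longlonglongrightarrow> a n" for n
    using LIMSEQ_subseq_LIMSEQ[OF _ assms(2), of "\<lambda>k. P k n" "a n"] assms(1)
    by (simp add: Hp_approx_def o_def)
qed

lemma Hp_approx_fast_subseq:
  assumes P: "Hp_approx p a P"
  obtains r where "strict_mono r" "\<And>j. poly_norm p (\<lambda>n. P (r (Suc j)) n - P (r j) n) \<le> (1 / 4) ^ j"
proof -
  have "\<exists>K. \<forall>j\<ge>K. \<forall>k\<ge>K. poly_norm p (\<lambda>n. P j n - P k n) < (1 / 4) ^ i" for i :: nat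
    using P by (simp add: Hp_approx_def)
  then obtain K where K: "\<And>i j k. j \<ge> K i \<Longrightarrow> k \<ge> K i \<Longrightarrow> poly_norm p (\<lambda>n. P j n - P k n) < (1 / 4) ^ i"
    by metis
  \<comment> \<open>Summing makes the indices strictly increasing and at least \<open>K j\<close>.\<close>
  define r where "r j = (\<Sum>i\<le>j. K i) + j" for j
  have r: "strict_mono r"
    by (rule strict_monoI_Suc) (simp add: r_def)
  have "K j \<le> r j" for j
    unfolding r_def by (rule trans_le_add1) (rule member_le_sum, auto)
  moreover have "r j \<le> r (Suc j)" for j
    using r by (simp add: strict_mono_def less_imp_le)
  ultimately have "poly_norm p (\<lambda>n. P (r (Suc j)) n - P (r j) n) < (1 / 4) ^ j" for j
    by (intro K) (auto intro: order_trans)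
  then show thesis
    using that[OF r] less_imp_le by blast
qed

text \<open>The infimum in \<open>Hp_norm\<close> ranges over a nonempty set: the norms along an approximating sequence
  are bounded, so they converge along a subsequence, which again approximates \<open>a\<close>.\<close>
lemma Hp_norm_limits_nonempty:
  assumes p: "0 < p" and P: "Hp_approx p a P"
  shows "\<exists>N P. Hp_approx p a P \<and> (\<lambda>k. poly_norm p (P k)) \<longlonglongrightarrow> N"
proof -
  have poly: "P j \<in> dirichlet_polys" for j
    using P by (simp add: Hp_approx_def)
  obtain K where K: "\<forall>j\<ge>K. \<forall>k\<ge>K. poly_norm p (\<lambda>n. P j n - P k n) < 1"
    using P unfolding Hp_approx_def by (meson zero_less_one)
  define B where "B = 2 powr p * (poly_norm p (P K) powr p + 1)"
  have bd: "poly_norm p (P (k + K)) \<le> B powr (1 / p)" for k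
  proof -
    have small: "poly_norm p (\<lambda>n. P (k + K) n - P K n) < 1"
      using K by simp
    have fin: "finite {n. P (k + K) n \<noteq> 0}" "finite {n. P K n \<noteq> 0}"
      using poly by (auto simp: dirichlet_polys_def)
    let ?A = "{n. P (k + K) n \<noteq> 0} \<union> {n. P K n \<noteq> 0}"
    let ?D = "\<lambda>n. P (k + K) n - P K n"
    have sup: "(\<Sum>n | Q n \<noteq> 0. Q n * mult_char chi n) = (\<Sum>n\<in>?A. Q n * mult_char chi n)"
      if "{n. Q n \<noteq> 0} \<subseteq> ?A" for Q :: "nat \<Rightarrow> complex" and chi
      using that fin by (intro sum.mono_neutral_left) auto
    have "poly_norm p (P (k + K)) powr p \<le> 2 powr p * (poly_norm p (P K) powr p + poly_norm p ?D powr p)"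
      unfolding poly_norm_powr[OF p]
    proof (rule torus_mean_quasi_triangle[OF p])
      fix chi
      have "(\<Sum>n | P (k + K) n \<noteq> 0. P (k + K) n * mult_char chi n) = (\<Sum>n\<in>?A. P (k + K) n * mult_char chi n)"
        "(\<Sum>n | P K n \<noteq> 0. P K n * mult_char chi n) = (\<Sum>n\<in>?A. P K n * mult_char chi n)"
        "(\<Sum>n | ?D n \<noteq> 0. ?D n * mult_char chi n) = (\<Sum>n\<in>?A. ?D n * mult_char chi n)"
        by (rule sup, force)+
      then have "(\<Sum>n | P (k + K) n \<noteq> 0. P (k + K) n * mult_char chi n)
          = (\<Sum>n | P K n \<noteq> 0. P K n * mult_char chi n) + (\<Sum>n | ?D n \<noteq> 0. ?D n * mult_char chi n)"
        by (simp only: sum.distrib[symmetric] ring_distribs add_diff_cancel_left' diff_add_cancel add_diff_eq)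
      then show "cmod (\<Sum>n | P (k + K) n \<noteq> 0. P (k + K) n * mult_char chi n)
          \<le> cmod (\<Sum>n | P K n \<noteq> 0. P K n * mult_char chi n) + cmod (\<Sum>n | ?D n \<noteq> 0. ?D n * mult_char chi n)"
        by (simp only: norm_triangle_ineq)
    qed
    also have "\<dots> \<le> B"
      unfolding B_def using small p powr_mono2[of p "poly_norm p ?D" 1]
      by (intro mult_left_mono add_left_mono) (auto simp: poly_norm_nonneg)
    finally have "(poly_norm p (P (k + K)) powr p) powr (1 / p) \<le> B powr (1 / p)"
      using p by (intro powr_mono2) auto
    then show ?thesis using p by (simp add: powr_powr poly_norm_nonneg)
  qed
  then have "bounded (range (\<lambda>k. poly_norm p (P (k + K))))"
    unfolding bounded_iff by (auto simp: poly_norm_nonneg)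
  then obtain N r where r: "strict_mono r" "((\<lambda>k. poly_norm p (P (k + K))) \<circ> r) \<longlonglongrightarrow> N"
    using bounded_imp_convergent_subsequence by blast
  have "strict_mono (\<lambda>k. r k + K)"
    using r(1) by (simp add: strict_mono_def)
  from Hp_approx_subseq[OF P this] r(2) show ?thesis
    by (auto simp: o_def)
qed

text \<open>Every admissible limit \<open>N\<close> of norms yields the bound \<open>N powr p\<close> by Fatou's lemma, because the vertical
  limit is the same function for all approximating sequences; then the infimum over \<open>N\<close> is taken.\<close>
lemma vertical_limit_mean:
  assumes p: "0 < p" and a: "a \<in> Hp p" and s: "0 < Re s"
  shows "\<exists>v\<in>borel_measurable torus_haar. AE chi in torus_haar. vertical_limit a chi s = v chi"
    and "(\<integral>\<^sup>+ chi. ennreal (cmod (vertical_limit a chi s) powr p) \<partial>torus_haar) \<le> ennreal (Hp_norm p a powr p)"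
proof -
  define S where "S = {N. \<exists>P. Hp_approx p a P \<and> (\<lambda>k. poly_norm p (P k)) \<longlonglongrightarrow> N}"
  let ?I = "\<integral>\<^sup>+ chi. ennreal (cmod (vertical_limit a chi s) powr p) \<partial>torus_haar"
  have main: "(\<exists>v\<in>borel_measurable torus_haar. AE chi in torus_haar. vertical_limit a chi s = v chi)
      \<and> ?I \<le> ennreal (N powr p) \<and> 0 \<le> N" if N: "N \<in> S" for N
  proof -
    obtain P where P: "Hp_approx p a P" "(\<lambda>k. poly_norm p (P k)) \<longlonglongrightarrow> N"
      using N by (auto simp: S_def)
    obtain r where r: "strict_mono r" "\<And>j. poly_norm p (\<lambda>n. P (r (Suc j)) n - P (r j) n) \<le> (1 / 4) ^ j"
      using Hp_approx_fast_subseq[OF P(1)] by blast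
    define Q where "Q = P \<circ> r"
    have Q: "Hp_approx p a Q"
      unfolding Q_def by (rule Hp_approx_subseq[OF P(1) r(1)])
    have QN: "(\<lambda>k. poly_norm p (Q k)) \<longlonglongrightarrow> N"
      using LIMSEQ_subseq_LIMSEQ[OF P(2) r(1)] by (simp add: Q_def o_def)
    have poly: "Q j \<in> dirichlet_polys" for j
      using Q by (simp add: Hp_approx_def)
    have lim: "AE chi in torus_haar. (\<lambda>j. dpoly (Q j) chi s) \<longlonglongrightarrow> vertical_limit a chi s"
    proof -
      have "AE chi in torus_haar. \<forall>s\<in>halfplane 0. (\<lambda>j. dpoly (Q j) chi s) \<longlonglongrightarrow> vertical_limit a chi s"
        by (rule AE_vertical_limit_of_fast_approx[OF p Q]) (simp add: Q_def r(2))
      then show ?thesis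
        by (rule eventually_mono) (use s in \<open>auto simp: halfplane_def\<close>)
    qed
    have N0: "0 \<le> N"
      using QN by (rule LIMSEQ_le_const) (auto simp: poly_norm_nonneg)
    have meas: "\<exists>v\<in>borel_measurable torus_haar. AE chi in torus_haar. vertical_limit a chi s = v chi"
    proof (rule bexI[where x = "\<lambda>chi. lim (\<lambda>j. dpoly (Q j) chi s)"])
      show "AE chi in torus_haar. vertical_limit a chi s = lim (\<lambda>j. dpoly (Q j) chi s)"
        using lim by (rule eventually_mono) (simp add: limI)
    qed (rule borel_measurable_lim_metric, measurable)
    have "?I = (\<integral>\<^sup>+ chi. liminf (\<lambda>j. ennreal (cmod (dpoly (Q j) chi s) powr p)) \<partial>torus_haar)"
    proof (rule nn_integral_cong_AE)
      show "AE chi in torus_haar. ennreal (cmod (vertical_limit a chi s) powr p) = liminf (\<lambda>j. ennreal (cmod (dpoly (Q j) chi s) powr p))"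
        using lim
      proof (rule eventually_mono)
        fix chi assume "(\<lambda>j. dpoly (Q j) chi s) \<longlonglongrightarrow> vertical_limit a chi s"
        then have "(\<lambda>j. ennreal (cmod (dpoly (Q j) chi s) powr p)) \<longlonglongrightarrow> ennreal (cmod (vertical_limit a chi s) powr p)"
          using p by (intro tendsto_ennrealI tendsto_powr' tendsto_intros) auto
        from lim_imp_Liminf[OF trivial_limit_sequentially this]
        show "ennreal (cmod (vertical_limit a chi s) powr p) = liminf (\<lambda>j. ennreal (cmod (dpoly (Q j) chi s) powr p))"
          by (rule sym)
      qed
    qed
    also have "\<dots> \<le> liminf (\<lambda>j. \<integral>\<^sup>+ chi. ennreal (cmod (dpoly (Q j) chi s) powr p) \<partial>torus_haar)"
      by (rule nn_integral_liminf) measurable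
    also have "\<dots> \<le> liminf (\<lambda>j. ennreal (poly_norm p (Q j) powr p))"
    proof (intro Liminf_mono always_eventually allI)
      fix j
      show "(\<integral>\<^sup>+ chi. ennreal (cmod (dpoly (Q j) chi s) powr p) \<partial>torus_haar) \<le> ennreal (poly_norm p (Q j) powr p)"
        using dpoly_mean_le[OF p poly[of j] s] by (subst nn_integral_eq_integral) (auto intro: ennreal_leI)
    qed
    also have "\<dots> = ennreal (N powr p)"
    proof (rule lim_imp_Liminf)
      show "(\<lambda>j. ennreal (poly_norm p (Q j) powr p)) \<longlonglongrightarrow> ennreal (N powr p)"
        using p by (intro tendsto_ennrealI tendsto_powr' QN tendsto_const) (auto simp: poly_norm_nonneg)
    qed simp
    finally show ?thesis using meas N0 by blast
  qed
  obtain N0 where N0: "N0 \<in> S"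
    using a Hp_norm_limits_nonempty[OF p] unfolding Hp_def S_def by blast
  show "\<exists>v\<in>borel_measurable torus_haar. AE chi in torus_haar. vertical_limit a chi s = v chi"
    using main[OF N0] by blast
  obtain i where i: "0 \<le> i" "?I = ennreal i"
  proof (cases ?I)
    case top
    then have "\<top> \<le> ennreal (N0 powr p)" using main[OF N0] by simp
    then show ?thesis by (simp add: top_unique)
  qed (use that in blast)
  have "i powr (1 / p) \<le> N" if "N \<in> S" for N
  proof -
    have "i \<le> N powr p" "0 \<le> N"
      using main[OF that] i by simp_all
    then have "i powr (1 / p) \<le> (N powr p) powr (1 / p)"
      using p i by (intro powr_mono2) auto
    then show ?thesis using p \<open>0 \<le> N\<close> by (simp add: powr_powr)
  qed
  then have "i powr (1 / p) \<le> Hp_norm p a"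
    unfolding Hp_norm_def S_def[symmetric] using N0 by (intro cInf_greatest) auto
  then have "(i powr (1 / p)) powr p \<le> Hp_norm p a powr p"
    using p by (intro powr_mono2) auto
  then show "?I \<le> ennreal (Hp_norm p a powr p)"
    using p i by (simp add: powr_powr ennreal_leI)
qed

lemma Hp_norm_nonneg:
  assumes "0 < p" "a \<in> Hp p"
  shows "0 \<le> Hp_norm p a"
  unfolding Hp_norm_def
proof (rule cInf_greatest)
  show "{N. \<exists>P. Hp_approx p a P \<and> (\<lambda>k. poly_norm p (P k)) \<longlonglongrightarrow> N} \<noteq> {}"
    using Hp_norm_limits_nonempty assms by (auto simp: Hp_def)
  fix N assume "N \<in> {N. \<exists>P. Hp_approx p a P \<and> (\<lambda>k. poly_norm p (P k)) \<longlonglongrightarrow> N}"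
  then show "0 \<le> N"
    by (auto intro!: LIMSEQ_le_const simp: poly_norm_nonneg)
qed

section \<open>A measure with sparse concentrated atoms\<close>
lemma ennreal_powr_ennreal: "0 \<le> x \<Longrightarrow> ennreal_powr (ennreal x) a = ennreal (x powr a)"
  by (simp add: ennreal_powr_def)

lemma ennreal_powr_mono:
  assumes "x \<le> y" "0 \<le> a"
  shows "ennreal_powr x a \<le> ennreal_powr y a"
proof (cases y)
  case (real r)
  then obtain q where q: "x = ennreal q" "0 \<le> q" "q \<le> r"
    using assms(1) by (cases x) (auto simp: top_unique)
  then show ?thesis
    using real assms(2) by (simp add: ennreal_powr_ennreal powr_mono2 ennreal_leI)
qed (simp add: ennreal_powr_def)

lemma ennreal_powr_measurable [measurable]: "(\<lambda>x. ennreal_powr x a) \<in> borel_measurable borel"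
  unfolding ennreal_powr_def by measurable

lemma borel_measurable_completion_AE:
  assumes g: "g \<in> borel_measurable M" and ae: "AE x in M. f x = g x"
  shows "f \<in> borel_measurable (completion M)"
proof (rule measurableI)
  fix A :: "'b set" assume "A \<in> sets borel"
  then have mem: "g -` A \<inter> space M \<in> sets (completion M)"
    using g by (auto intro: sets_completionI_sets measurable_sets)
  have "AE x in completion M. x \<in> g -` A \<inter> space M \<longleftrightarrow> x \<in> f -` A \<inter> space M"
    using ae by (intro AE_completion) (auto elim: eventually_mono)
  from completion.in_sets_AE[OF this mem] show "f -` A \<inter> space (completion M) \<in> sets (completion M)"
    by simp
qed simp

lemma AE_pair_fst:
  assumes M2: "sigma_finite_measure M2" and ae: "AE x in M1. P x"
  shows "AE z in M1 \<Otimes>\<^sub>M M2. P (fst z)"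
proof -
  interpret sigma_finite_measure M2 by fact
  obtain N where N: "{x\<in>space M1. \<not> P x} \<subseteq> N" "N \<in> null_sets M1"
    using ae by (auto elim!: AE_E simp: null_sets_def)
  have "N \<times> space M2 \<in> null_sets (M1 \<Otimes>\<^sub>M M2)"
    using N(2) by (intro times_in_null_sets1) auto
  then show ?thesis
    by (rule AE_I') (use N(1) in \<open>auto simp: space_pair_measure\<close>)
qed

definition atom_re :: "nat \<Rightarrow> real" where
  "atom_re k = (if even k then 0 else 1 / 2) + (1 / 4) ^ k"

text \<open>Factorial growth outweighs every power \<open>(2\<^sup>k)\<^sup>p\<^sup>/\<^sup>l\<close>, so that one sequence of heights serves all exponents.
  The factor \<open>4\<close> and the shift of \<open>k\<close>, which avoids \<open>0! = 1!\<close>, make consecutive heights differ by at least \<open>4\<close>,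
  more than the width of a window.\<close>
definition atom_im :: "nat \<Rightarrow> real" where
  "atom_im k = 4 * fact (k + 1)"

definition atom :: "nat \<Rightarrow> complex" where
  "atom k = Complex (atom_re k) (atom_im k)"

definition sparse_measure :: "complex measure" where
  "sparse_measure = distr (measure_pmf (geometric_pmf (1 / 2))) (restrict_space borel (halfplane 0)) atom"

lemma atom_re_bounds: "(1 / 4) ^ k \<le> atom_re k" "0 < atom_re k" "atom_re k \<le> 3 / 2"
  using power_le_one[of "1 / 4 :: real" k] by (auto simp: atom_re_def add_pos_pos)

lemma atom_in_halfplane: "atom k \<in> halfplane 0"
  using atom_re_bounds by (simp add: halfplane_def atom_def)

lemma sets_sparse_measure: "sets sparse_measure = sets (restrict_space borel (halfplane 0))"
  by (simp add: sparse_measure_def)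

lemma atom_measurable: "atom \<in> measure_pmf q \<rightarrow>\<^sub>M restrict_space borel (halfplane 0)"
  using atom_in_halfplane by (auto simp: space_restrict_space)

lemma prob_space_sparse_measure: "prob_space sparse_measure"
  unfolding sparse_measure_def by (rule measure_pmf.prob_space_distr[OF atom_measurable])

lemma nn_integral_sparse_measure:
  assumes "f \<in> borel_measurable (restrict_space borel (halfplane 0))"
  shows "(\<integral>\<^sup>+ s. f s \<partial>sparse_measure) = (\<Sum>k. ennreal ((1 / 2) ^ Suc k) * f (atom k))"
  unfolding sparse_measure_def using assms
  by (subst nn_integral_distr[OF atom_measurable])
     (auto simp: nn_integral_measure_pmf nn_integral_count_space_nat)

text \<open>The vertices of those cones that contain the \<open>k\<close>-th atom.\<close>
definition window :: "nat \<Rightarrow> real set" where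
  "window k = {\<tau>. \<bar>atom_im k - \<tau>\<bar> < atom_re k}"

lemma window_measurable [measurable]: "window k \<in> sets borel"
  unfolding window_def by measurable

lemma atom_in_nt_cone_iff: "atom k \<in> nt_cone \<tau> \<longleftrightarrow> \<tau> \<in> window k"
  using atom_in_halfplane[of k] by (simp add: nt_cone_def window_def atom_def)

lemma atom_im_gap:
  assumes "j < k"
  shows "atom_im j + 4 \<le> atom_im k"
proof -
  have "(fact (j + 2) :: real) \<le> fact (k + 1)"
    using assms by (intro fact_mono) auto
  moreover have "(fact (j + 2) :: real) = (real j + 2) * fact (j + 1)"
    by (simp add: algebra_simps)
  moreover have "2 * fact (j + 1) \<le> (real j + 2) * fact (j + 1)"
    by (intro mult_right_mono) auto
  moreover have "(1 :: real) \<le> fact (j + 1)"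
    by (rule fact_ge_1)
  ultimately show ?thesis
    unfolding atom_im_def by linarith
qed

lemma window_disjoint:
  assumes "\<tau> \<in> window j" "\<tau> \<in> window k"
  shows "j = k"
proof (rule ccontr)
  assume "j \<noteq> k"
  then have "atom_im j + 4 \<le> atom_im k \<or> atom_im k + 4 \<le> atom_im j"
    using atom_im_gap[of j k] atom_im_gap[of k j] by linarith
  then show False
    using assms atom_re_bounds(3)[of j] atom_re_bounds(3)[of k]
    unfolding window_def mem_Collect_eq by linarith
qed

definition cauchy_weight :: "real measure" where
  "cauchy_weight = density lborel (\<lambda>\<tau>. ennreal (1 / (1 + \<tau>\<^sup>2)))"

lemma sets_cauchy_weight [measurable_cong, simp]: "sets cauchy_weight = sets borel"
  by (simp add: cauchy_weight_def)

lemma space_cauchy_weight [simp]: "space cauchy_weight = UNIV"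
  by (simp add: cauchy_weight_def)

lemma Li_measure_eq: "Li_measure = completion (torus_haar \<Otimes>\<^sub>M cauchy_weight)"
  by (simp add: Li_measure_def cauchy_weight_def)

lemma cauchy_weight_window_le: "emeasure cauchy_weight (window k) \<le> ennreal (3 / fact k)"
proof -
  have "emeasure cauchy_weight (window k) = (\<integral>\<^sup>+ \<tau>. ennreal (1 / (1 + \<tau>\<^sup>2)) * indicator (window k) \<tau> \<partial>lborel)"
    unfolding cauchy_weight_def by (rule emeasure_density) auto
  also have "\<dots> \<le> (\<integral>\<^sup>+ \<tau>. ennreal (1 / fact k) * indicator {atom_im k - 3 / 2..atom_im k + 3 / 2} \<tau> \<partial>lborel)"
  proof (rule nn_integral_mono)
    fix \<tau> :: real
    show "ennreal (1 / (1 + \<tau>\<^sup>2)) * indicator (window k) \<tau>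
        \<le> ennreal (1 / fact k) * indicator {atom_im k - 3 / 2..atom_im k + 3 / 2} \<tau>"
    proof (cases "\<tau> \<in> window k")
      case True
      then have \<tau>: "\<bar>atom_im k - \<tau>\<bar> < 3 / 2"
        using atom_re_bounds(3)[of k] by (simp add: window_def)
      have k: "(1 :: real) \<le> fact (k + 1)" "(fact k :: real) \<le> fact (k + 1)"
        by (rule fact_ge_1, intro fact_mono) auto
      then have "fact k \<le> \<tau>" "1 \<le> \<tau>"
        using \<tau> unfolding atom_im_def by linarith+
      then have "fact k * 1 \<le> \<tau> * \<tau>"
        by (intro mult_mono) auto
      then have "1 / (1 + \<tau>\<^sup>2) \<le> 1 / fact k"
        by (intro divide_left_mono) (auto simp: power2_eq_square intro!: mult_pos_pos add_pos_nonneg)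
      then show ?thesis
        using \<tau> by (auto simp: indicator_def abs_less_iff intro!: ennreal_leI)
    qed simp
  qed
  also have "\<dots> = ennreal (1 / fact k) * ennreal 3"
    by (subst nn_integral_cmult_indicator) auto
  also have "\<dots> = ennreal (3 / fact k)"
    by (subst ennreal_mult''[symmetric]) auto
  finally show ?thesis .
qed

lemma nn_integral_inverse_square_finite: "(\<integral>\<^sup>+ t. ennreal (1 / (1 + t\<^sup>2)) \<partial>lborel) < \<top>"
proof -
  have half: "(\<integral>\<^sup>+ t. ennreal (1 / (1 + t\<^sup>2)) * indicator {0..} t \<partial>lborel) = ennreal (pi / 2 - arctan 0)"
    by (rule nn_integral_FTC_atLeast)
       (auto intro!: derivative_eq_intros tendsto_arctan_at_top simp: add_nonneg_eq_0_iff field_simps power2_eq_square)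
  have "(\<integral>\<^sup>+ t. ennreal (1 / (1 + t\<^sup>2)) \<partial>lborel)
      \<le> (\<integral>\<^sup>+ t. ennreal (1 / (1 + t\<^sup>2)) * indicator {0..} t + ennreal (1 / (1 + (- t)\<^sup>2)) * indicator {0..} (- t) \<partial>lborel)"
    by (intro nn_integral_mono) (auto simp: indicator_def)
  also have "\<dots> = (\<integral>\<^sup>+ t. ennreal (1 / (1 + t\<^sup>2)) * indicator {0..} t \<partial>lborel)
      + (\<integral>\<^sup>+ t. ennreal (1 / (1 + (- t)\<^sup>2)) * indicator {0..} (- t) \<partial>lborel)"
    by (rule nn_integral_add) measurable
  also have "(\<integral>\<^sup>+ t. ennreal (1 / (1 + (- t)\<^sup>2)) * indicator {0..} (- t) \<partial>lborel)
      = (\<integral>\<^sup>+ t. ennreal (1 / (1 + t\<^sup>2)) * indicator {0..} t \<partial>lborel)"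
    using nn_integral_real_affine[of "\<lambda>t. ennreal (1 / (1 + t\<^sup>2)) * indicator {0..} t" "- 1" 0] by simp
  finally show ?thesis
    unfolding half by (auto simp: le_less_trans)
qed

lemma finite_measure_cauchy_weight: "finite_measure cauchy_weight"
  using nn_integral_inverse_square_finite
  by (intro finite_measureI) (simp add: cauchy_weight_def emeasure_density)

section \<open>Boundedness of the area operators\<close>
lemma area_op_sparse_measure:
  assumes l: "0 < l"
  shows "area_op sparse_measure l a (chi, \<tau>) = ennreal_powr
    (\<Sum>k. ennreal ((1 / 2) ^ Suc k * cmod (vertical_limit a chi (atom k)) powr l / atom_re k) * indicator (window k) \<tau>) (1 / l)"
proof -
  let ?M = "restrict_space borel (halfplane 0)"
  have [measurable]: "vertical_limit a chi \<in> borel_measurable ?M"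
    by (rule vertical_limit_measurable)
  have [measurable]: "Re \<in> borel_measurable ?M"
    by (rule measurable_restrict_space1) simp
  have "nt_cone \<tau> \<in> sets borel"
    unfolding nt_cone_def halfplane_def by measurable
  then have [measurable]: "(indicator (nt_cone \<tau>) :: complex \<Rightarrow> ennreal) \<in> borel_measurable ?M"
    by (intro measurable_restrict_space1 borel_measurable_indicator)
  have "(\<lambda>s. ennreal (cmod (vertical_limit a chi s) powr l / Re s) * indicator (nt_cone \<tau>) s) \<in> borel_measurable ?M"
    by measurable
  from nn_integral_sparse_measure[OF this]
  have "(\<integral>\<^sup>+ s\<in>nt_cone \<tau>. ennreal (cmod (vertical_limit a chi s) powr l / Re s) \<partial>sparse_measure)
      = (\<Sum>k. ennreal ((1 / 2) ^ Suc k) * (ennreal (cmod (vertical_limit a chi (atom k)) powr l / Re (atom k)) * indicator (nt_cone \<tau>) (atom k)))" .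
  also have "\<dots> = (\<Sum>k. ennreal ((1 / 2) ^ Suc k * cmod (vertical_limit a chi (atom k)) powr l / atom_re k) * indicator (window k) \<tau>)"
  proof (rule suminf_cong)
    fix k
    have "indicator (nt_cone \<tau>) (atom k) = (indicator (window k) \<tau> :: ennreal)"
      by (simp add: indicator_def atom_in_nt_cone_iff)
    moreover have "ennreal ((1 / 2) ^ Suc k) * ennreal (cmod (vertical_limit a chi (atom k)) powr l / Re (atom k))
       = ennreal ((1 / 2) ^ Suc k * cmod (vertical_limit a chi (atom k)) powr l / atom_re k)"
      using atom_re_bounds(2)[of k] by (subst ennreal_mult''[symmetric]) (auto simp: atom_def)
    ultimately show "ennreal ((1 / 2) ^ Suc k) * (ennreal (cmod (vertical_limit a chi (atom k)) powr l / Re (atom k)) * indicator (nt_cone \<tau>) (atom k))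
       = ennreal ((1 / 2) ^ Suc k * cmod (vertical_limit a chi (atom k)) powr l / atom_re k) * indicator (window k) \<tau>"
      by (simp add: mult.assoc[symmetric])
  qed
  finally show ?thesis by (simp add: area_op_def)
qed

lemma suminf_window_single:
  fixes f :: "nat \<Rightarrow> ennreal"
  assumes "\<tau> \<in> window k"
  shows "(\<Sum>j. f j * indicator (window j) \<tau>) = f k"
proof -
  have "(\<Sum>j. f j * indicator (window j) \<tau>) = (\<Sum>j\<in>{k}. f j * indicator (window j) \<tau>)"
    using assms by (intro suminf_finite) (auto simp: indicator_def dest: window_disjoint)
  then show ?thesis using assms by simp
qed

text \<open>At most one atom lies in each cone, so that powers of the area function can be taken term by term.\<close>
lemma area_op_powr:
  assumes l: "0 < l" and p: "0 < p"
  shows "ennreal_powr (area_op sparse_measure l a (chi, \<tau>)) p =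
    (\<Sum>k. ennreal (((1 / 2) ^ Suc k / atom_re k) powr (p / l)) * ennreal (cmod (vertical_limit a chi (atom k)) powr p) * indicator (window k) \<tau>)"
proof (cases "\<exists>k. \<tau> \<in> window k")
  case True
  then obtain k where k: "\<tau> \<in> window k" by blast
  let ?v = "cmod (vertical_limit a chi (atom k))"
  let ?c = "(1 / 2) ^ Suc k / atom_re k"
  have c: "0 \<le> ?c" using atom_re_bounds(2)[of k] by simp
  have "((?c * ?v powr l) powr (1 / l)) powr p = ?c powr (p / l) * ?v powr p"
    using l p by (simp only: powr_powr powr_mult) (simp add: field_simps)
  moreover have "0 \<le> ?c * ?v powr l"
    by (rule mult_nonneg_nonneg[OF c]) simp
  ultimately have "ennreal_powr (ennreal_powr (ennreal (?c * ?v powr l)) (1 / l)) p = ennreal (?c powr (p / l)) * ennreal (?v powr p)"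
    by (simp only: ennreal_powr_ennreal powr_ge_zero ennreal_mult''[symmetric])
  then show ?thesis
    unfolding area_op_sparse_measure[OF l] suminf_window_single[OF k] by simp
next
  case False
  then have "indicator (window k) \<tau> = (0 :: ennreal)" for k by simp
  then show ?thesis
    unfolding area_op_sparse_measure[OF l] by (simp add: ennreal_powr_def)
qed

text \<open>The ratio of mass to real part is at most \<open>2\<^sup>k\<close>, so the series is dominated by three times the
  exponential series at \<open>2 powr q\<close>.\<close>
lemma summable_window_weights:
  "summable (\<lambda>k. ((1 / 2) ^ Suc k / atom_re k) powr q * (3 / fact k))" if "0 \<le> q"
proof (rule summable_comparison_test')
  show "summable (\<lambda>k. 3 * ((2 powr q) ^ k / fact k))"
    using summable_exp[of "2 powr q"] by (intro summable_mult) (simp add: field_simps)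
  fix k :: nat assume "k \<ge> 0"
  have "(1 / 2) ^ Suc k / atom_re k \<le> (1 / 2) ^ Suc k / (1 / 4) ^ k"
    using atom_re_bounds[of k] by (intro divide_left_mono mult_pos_pos) auto
  also have "\<dots> = 2 ^ k / 2"
  proof -
    have "(4 :: real) ^ k = 2 ^ k * 2 ^ k" by (simp add: power_mult_distrib[symmetric])
    then show ?thesis by (simp add: field_simps)
  qed
  also have "\<dots> \<le> 2 ^ k" by simp
  finally have "((1 / 2) ^ Suc k / atom_re k) powr q \<le> (2 ^ k) powr q"
    using that atom_re_bounds(2)[of k] by (intro powr_mono2) auto
  also have "\<dots> = (2 powr q) ^ k"
    by (simp add: powr_realpow[symmetric] powr_powr mult.commute)
  finally have "((1 / 2) ^ Suc k / atom_re k) powr q * (3 / fact k) \<le> (2 powr q) ^ k * (3 / fact k)"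
    by (rule mult_right_mono) simp
  then show "norm (((1 / 2) ^ Suc k / atom_re k) powr q * (3 / fact k)) \<le> 3 * ((2 powr q) ^ k / fact k)"
    by (simp add: abs_mult mult_ac)
qed

lemma area_op_bounded_sparse_measure:
  assumes p: "0 < p" and l: "0 < l" and X: "X \<subseteq> Hp p"
  shows "area_op_bounded sparse_measure l p X"
proof -
  interpret W: finite_measure cauchy_weight by (rule finite_measure_cauchy_weight)
  let ?Pi = "torus_haar \<Otimes>\<^sub>M cauchy_weight"
  define c where "c k = ((1 / 2) ^ Suc k / atom_re k) powr (p / l)" for k
  define S where "S = (\<Sum>k. c k * (3 / fact k))"
  have c0: "0 \<le> c k" for k by (simp add: c_def)
  have sumS: "summable (\<lambda>k. c k * (3 / fact k))"
    unfolding c_def using p l by (intro summable_window_weights) auto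
  have S0: "0 \<le> S" unfolding S_def using sumS c0 by (intro suminf_nonneg) auto
  have main: "area_op sparse_measure l a \<in> borel_measurable Li_measure \<and>
      Lp_norm Li_measure p (area_op sparse_measure l a) \<le> ennreal (S powr (1 / p) * Hp_norm p a)" if a: "a \<in> Hp p" for a
  proof -
    have Re_atom: "0 < Re (atom k)" for k
      using atom_re_bounds(2) by (simp add: atom_def)
    have "\<exists>v. \<forall>k. v k \<in> borel_measurable torus_haar \<and> (AE chi in torus_haar. vertical_limit a chi (atom k) = v k chi)"
      using vertical_limit_mean(1)[OF p a Re_atom] by metis
    then obtain v where v [measurable]: "\<And>k. v k \<in> borel_measurable torus_haar"
      and v_eq: "\<And>k. AE chi in torus_haar. vertical_limit a chi (atom k) = v k chi"
      by blast
    have "AE chi in torus_haar. \<forall>k. vertical_limit a chi (atom k) = v k chi"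
      using v_eq by (simp add: AE_all_countable)
    then have ae: "AE z in ?Pi. \<forall>k. vertical_limit a (fst z) (atom k) = v k (fst z)"
      by (rule AE_pair_fst[OF W.sigma_finite_measure_axioms])
    have "area_op sparse_measure l a \<in> borel_measurable (completion ?Pi)"
    proof (rule borel_measurable_completion_AE)
      let ?g = "\<lambda>z. ennreal_powr (\<Sum>k. ennreal ((1 / 2) ^ Suc k * cmod (v k (fst z)) powr l / atom_re k) * indicator (window k) (snd z)) (1 / l)"
      show "?g \<in> borel_measurable ?Pi" by measurable
      show "AE z in ?Pi. area_op sparse_measure l a z = ?g z"
        using ae by (rule eventually_mono) (auto simp: area_op_sparse_measure[OF l])
    qed
    then have meas: "area_op sparse_measure l a \<in> borel_measurable Li_measure"
      by (simp add: Li_measure_eq)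
    have mean: "(\<integral>\<^sup>+ chi. ennreal (cmod (v k chi) powr p) \<partial>torus_haar) \<le> ennreal (Hp_norm p a powr p)" for k
    proof -
      have "(\<integral>\<^sup>+ chi. ennreal (cmod (v k chi) powr p) \<partial>torus_haar) = (\<integral>\<^sup>+ chi. ennreal (cmod (vertical_limit a chi (atom k)) powr p) \<partial>torus_haar)"
        using v_eq[of k] by (intro nn_integral_cong_AE) (auto elim: eventually_mono)
      then show ?thesis
        using vertical_limit_mean(2)[OF p a Re_atom] by simp
    qed
    have "(\<integral>\<^sup>+ z. ennreal_powr (area_op sparse_measure l a z) p \<partial>Li_measure)
        = (\<integral>\<^sup>+ z. ennreal_powr (area_op sparse_measure l a z) p \<partial>?Pi)"
      unfolding Li_measure_eq by (rule nn_integral_completion)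
    also have "\<dots> = (\<integral>\<^sup>+ z. (\<Sum>k. ennreal (c k) * ennreal (cmod (v k (fst z)) powr p) * indicator (window k) (snd z)) \<partial>?Pi)"
      using ae by (intro nn_integral_cong_AE) (auto elim!: eventually_mono simp: area_op_powr[OF l p] c_def)
    also have "\<dots> = (\<Sum>k. \<integral>\<^sup>+ z. ennreal (c k) * ennreal (cmod (v k (fst z)) powr p) * indicator (window k) (snd z) \<partial>?Pi)"
      by (rule nn_integral_suminf) measurable
    also have "\<dots> \<le> (\<Sum>k. ennreal (Hp_norm p a powr p) * ennreal (c k * (3 / fact k)))"
    proof (intro suminf_le allI)
      fix k
      have "(\<integral>\<^sup>+ z. ennreal (c k) * ennreal (cmod (v k (fst z)) powr p) * indicator (window k) (snd z) \<partial>?Pi)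
          = (\<integral>\<^sup>+ chi. \<integral>\<^sup>+ \<tau>. ennreal (c k) * ennreal (cmod (v k chi) powr p) * indicator (window k) \<tau> \<partial>cauchy_weight \<partial>torus_haar)"
      proof -
        have "(\<lambda>z. ennreal (c k) * ennreal (cmod (v k (fst z)) powr p) * indicator (window k) (snd z)) \<in> borel_measurable ?Pi"
          by measurable
        from W.nn_integral_fst[OF this] show ?thesis by simp
      qed
      also have "\<dots> = (\<integral>\<^sup>+ chi. (ennreal (c k) * emeasure cauchy_weight (window k)) * ennreal (cmod (v k chi) powr p) \<partial>torus_haar)"
        by (intro nn_integral_cong, subst nn_integral_cmult_indicator) (simp_all add: mult_ac)
      also have "\<dots> = (ennreal (c k) * emeasure cauchy_weight (window k)) * (\<integral>\<^sup>+ chi. ennreal (cmod (v k chi) powr p) \<partial>torus_haar)"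
        by (rule nn_integral_cmult) measurable
      also have "\<dots> \<le> (ennreal (c k) * ennreal (3 / fact k)) * ennreal (Hp_norm p a powr p)"
        by (intro mult_mono cauchy_weight_window_le mean) auto
      also have "\<dots> = ennreal (Hp_norm p a powr p) * ennreal (c k * (3 / fact k))"
      proof -
        have "ennreal (c k * (3 / fact k)) = ennreal (c k) * ennreal (3 / fact k)"
          by (rule ennreal_mult'') simp
        then show ?thesis by (simp only: mult_ac)
      qed
      finally show "(\<integral>\<^sup>+ z. ennreal (c k) * ennreal (cmod (v k (fst z)) powr p) * indicator (window k) (snd z) \<partial>?Pi)
          \<le> ennreal (Hp_norm p a powr p) * ennreal (c k * (3 / fact k))" .
    qed auto
    also have "\<dots> = ennreal (Hp_norm p a powr p) * ennreal S"
      unfolding S_def using sumS c0 by (subst ennreal_suminf_cmult) (auto simp: suminf_ennreal2)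
    also have "\<dots> = ennreal (S * Hp_norm p a powr p)"
      using S0 by (simp add: ennreal_mult'' mult.commute)
    finally have "Lp_norm Li_measure p (area_op sparse_measure l a) \<le> ennreal_powr (ennreal (S * Hp_norm p a powr p)) (1 / p)"
      unfolding Lp_norm_def using p by (intro ennreal_powr_mono) auto
    also have "\<dots> = ennreal (S powr (1 / p) * Hp_norm p a)"
      using p S0 Hp_norm_nonneg[OF p a] by (simp add: ennreal_powr_ennreal powr_mult powr_powr)
    finally show ?thesis using meas by simp
  qed
  show ?thesis
    unfolding area_op_bounded_def
    using main X by (intro conjI ballI exI[of _ "S powr (1 / p)"]) auto
qed

section \<open>Failure of the Carleson conditions\<close>

text \<open>The mass of an atom is not bounded by a multiple of its distance to the line \<open>Re s = \<theta>\<close>.\<close>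
definition heavy_atoms :: "real \<Rightarrow> complex measure \<Rightarrow> bool" where
  "heavy_atoms \<theta> \<nu> \<longleftrightarrow> (\<forall>B::real. \<exists>h>0. \<exists>t. ennreal (B * h) \<le> emeasure \<nu> {Complex (\<theta> + h) t})"

lemma heavy_atoms_not_carleson:
  assumes sets: "sets \<nu> = sets (restrict_space borel (halfplane \<theta>))" and heavy: "heavy_atoms \<theta> \<nu>"
  shows "\<not> carleson_measure \<theta> \<nu>"
proof
  let ?\<I> = "{I. is_interval I \<and> bounded I \<and> 0 < measure lborel I}"
  let ?S = "SUP I\<in>?\<I>. emeasure \<nu> (carleson_square \<theta> I) / ennreal (measure lborel I)"
  assume "carleson_measure \<theta> \<nu>"
  then have "?S < \<top>" by (simp add: carleson_measure_def)
  then obtain C where C: "0 \<le> C" "?S = ennreal C"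
    by (cases ?S) auto
  obtain h t where h: "0 < h" "ennreal ((C + 1) * h) \<le> emeasure \<nu> {Complex (\<theta> + h) t}"
    using heavy unfolding heavy_atoms_def by blast
  define I where "I = {t..t + h}"
  have len: "measure lborel I = h" using h(1) by (simp add: I_def)
  have I: "I \<in> ?\<I>" using h(1) len by (auto simp: I_def is_interval_cc)
  have sub: "carleson_square \<theta> I \<subseteq> halfplane \<theta>"
    by (auto simp: carleson_square_def halfplane_def)
  have "carleson_square \<theta> I \<in> sets borel"
    unfolding carleson_square_def I_def by measurable
  then have meas: "carleson_square \<theta> I \<in> sets \<nu>"
    unfolding sets sets_restrict_space using sub by (intro image_eqI[of _ _ "carleson_square \<theta> I"]) auto
  have "{Complex (\<theta> + h) t} \<subseteq> carleson_square \<theta> I"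
    using h(1) len by (auto simp: carleson_square_def I_def)
  then have "ennreal ((C + 1) * h) \<le> emeasure \<nu> (carleson_square \<theta> I)"
    by (intro order_trans[OF h(2)] emeasure_mono meas)
  then have "ennreal ((C + 1) * h) / ennreal h \<le> emeasure \<nu> (carleson_square \<theta> I) / ennreal (measure lborel I)"
    unfolding len by (rule divide_right_mono_ennreal)
  also have "\<dots> \<le> ?S" by (rule SUP_upper[OF I])
  finally have "ennreal (C + 1) \<le> ennreal C"
    using h(1) C by (simp add: divide_ennreal)
  then show False using C(1) by simp
qed

lemma nn_integral_shifted_cauchy:
  assumes h: "0 < h"
  shows "(\<integral>\<^sup>+ t. ennreal (1 / (h\<^sup>2 + (t - t0)\<^sup>2)) \<partial>lborel) = ennreal (1 / h) * (\<integral>\<^sup>+ t. ennreal (1 / (1 + t\<^sup>2)) \<partial>lborel)"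
proof -
  have "(\<integral>\<^sup>+ t. ennreal (1 / (h\<^sup>2 + (t - t0)\<^sup>2)) \<partial>lborel)
      = ennreal h * (\<integral>\<^sup>+ y. ennreal (1 / (h\<^sup>2 + (t0 + h * y - t0)\<^sup>2)) \<partial>lborel)"
    using nn_integral_real_affine[of "\<lambda>t. ennreal (1 / (h\<^sup>2 + (t - t0)\<^sup>2))" h t0] h by simp
  also have "\<dots> = (\<integral>\<^sup>+ y. ennreal h * ennreal (1 / (h\<^sup>2 + (t0 + h * y - t0)\<^sup>2)) \<partial>lborel)"
    by (rule nn_integral_cmult[symmetric]) measurable
  also have "\<dots> = (\<integral>\<^sup>+ y. ennreal (1 / h) * ennreal (1 / (1 + y\<^sup>2)) \<partial>lborel)"
  proof (rule nn_integral_cong)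
    fix y
    have "h * (1 / (h\<^sup>2 + (t0 + h * y - t0)\<^sup>2)) = h / (h * h * (1 + y\<^sup>2))"
      by (simp add: power2_eq_square algebra_simps)
    also have "\<dots> = 1 / h * (1 / (1 + y\<^sup>2))" using h by simp
    finally show "ennreal h * ennreal (1 / (h\<^sup>2 + (t0 + h * y - t0)\<^sup>2)) = ennreal (1 / h) * ennreal (1 / (1 + y\<^sup>2))"
      using h by (simp add: ennreal_mult''[symmetric] del: add_diff_cancel_left' mult_1)
  qed
  also have "\<dots> = ennreal (1 / h) * (\<integral>\<^sup>+ t. ennreal (1 / (1 + t\<^sup>2)) \<partial>lborel)"
    by (rule nn_integral_cmult) measurable
  finally show ?thesis .
qed

text \<open>The test function \<open>(s - \<theta> + h - \<i> t0)\<^sup>-\<^sup>M\<close> has its pole at the reflection of the atom in the line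
  \<open>Re s = \<theta>\<close>. With \<open>q = M p \<ge> 2\<close>, its norm to the power \<open>p\<close> is at most a constant times \<open>h powr (1 - q)\<close>, as
  the weight \<open>1 / (1 + t\<^sup>2)\<close> is at most \<open>1\<close>, while an atom of mass \<open>B h\<close> contributes
  \<open>2 powr (- q) * B * h powr (1 - q)\<close> to the integral. So \<open>B\<close> would be bounded.\<close>
lemma heavy_atoms_not_Hpi_carleson:
  assumes p: "0 < p" and heavy: "heavy_atoms \<theta> \<nu>"
  shows "\<not> Hpi_carleson_measure \<theta> p \<nu>"
proof
  assume "Hpi_carleson_measure \<theta> p \<nu>"
  then obtain C where C: "0 \<le> C"
    "\<And>f. f \<in> Hpi \<theta> p \<Longrightarrow> Lp_norm \<nu> p (\<lambda>s. ennreal (cmod (f s))) \<le> ennreal C * Hpi_norm \<theta> p f"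
    unfolding Hpi_carleson_measure_def by blast
  obtain J where J: "0 \<le> J" "(\<integral>\<^sup>+ t. ennreal (1 / (1 + t\<^sup>2)) \<partial>lborel) = ennreal J"
    using nn_integral_inverse_square_finite by (cases "\<integral>\<^sup>+ t. ennreal (1 / (1 + t\<^sup>2)) \<partial>lborel") auto
  obtain M :: nat where M: "2 / p \<le> real M"
    using real_arch_simple by blast
  define q where "q = real M * p"
  have q: "2 \<le> q" using M p by (simp add: q_def field_simps)
  \<comment> \<open>One more than the largest \<open>B\<close> that the embedding with constant \<open>C\<close> permits.\<close>
  define B where "B = 2 powr q * (C powr p * (J / pi)) + 1"
  have B: "0 < B" using J C by (auto simp: B_def intro!: add_nonneg_pos)
  obtain h t0 where h: "0 < h" "ennreal (B * h) \<le> emeasure \<nu> {Complex (\<theta> + h) t0}"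
    using heavy unfolding heavy_atoms_def by blast
  define w where "w s = s - of_real \<theta> + of_real h - \<i> * of_real t0" for s
  define f where "f s = (1 / w s) ^ M" for s
  have w_nz: "w s \<noteq> 0" if "s \<in> halfplane \<theta>" for s
  proof
    assume "w s = 0"
    then have "Re (w s) = 0" by simp
    then show False using that h by (simp add: w_def halfplane_def)
  qed
  have f_hol: "f holomorphic_on halfplane \<theta>"
    unfolding f_def using w_nz by (intro holomorphic_intros) (auto simp: w_def intro!: holomorphic_intros)
  have f_norm: "cmod (f s) powr p = cmod (w s) powr (- q)" if "w s \<noteq> 0" for s
    using that by (simp add: f_def norm_power norm_divide q_def powr_realpow[symmetric] powr_powr powr_minus_divide powr_divide power_divide)
  have f_bd: "cmod (f (Complex \<sigma> t)) powr p / (1 + t\<^sup>2) \<le> h powr (2 - q) * (1 / (h\<^sup>2 + (t - t0)\<^sup>2))" if \<sigma>: "\<theta> < \<sigma>" for \<sigma> t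
  proof -
    have "h\<^sup>2 \<le> (\<sigma> - \<theta> + h)\<^sup>2" using \<sigma> h by (intro power_mono) auto
    moreover have "(cmod (w (Complex \<sigma> t)))\<^sup>2 = (\<sigma> - \<theta> + h)\<^sup>2 + (t - t0)\<^sup>2"
      by (simp add: w_def cmod_power2)
    ultimately have w2: "h\<^sup>2 + (t - t0)\<^sup>2 \<le> (cmod (w (Complex \<sigma> t)))\<^sup>2" by simp
    have "\<sigma> - \<theta> + h \<le> cmod (w (Complex \<sigma> t))"
      using complex_Re_le_cmod[of "w (Complex \<sigma> t)"] by (simp add: w_def)
    then have w1: "h \<le> cmod (w (Complex \<sigma> t))" using \<sigma> by linarith
    have "w (Complex \<sigma> t) \<noteq> 0" using w1 h by auto
    then have "cmod (f (Complex \<sigma> t)) powr p = cmod (w (Complex \<sigma> t)) powr (2 - q) * cmod (w (Complex \<sigma> t)) powr (- 2)"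
      by (simp add: f_norm powr_add[symmetric])
    also have "\<dots> \<le> h powr (2 - q) * (1 / (h\<^sup>2 + (t - t0)\<^sup>2))"
    proof (rule mult_mono)
      show "cmod (w (Complex \<sigma> t)) powr (2 - q) \<le> h powr (2 - q)"
        using w1 h q by (intro powr_mono2') auto
      have "cmod (w (Complex \<sigma> t)) powr (- 2) = 1 / (cmod (w (Complex \<sigma> t)))\<^sup>2"
        using w1 h by (simp add: powr_minus_divide powr_numeral)
      also have "\<dots> \<le> 1 / (h\<^sup>2 + (t - t0)\<^sup>2)"
        using w2 h \<open>w (Complex \<sigma> t) \<noteq> 0\<close> by (intro divide_left_mono) (auto intro!: mult_pos_pos add_pos_nonneg)
      finally show "cmod (w (Complex \<sigma> t)) powr (- 2) \<le> 1 / (h\<^sup>2 + (t - t0)\<^sup>2)" .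
    qed auto
    finally have "cmod (f (Complex \<sigma> t)) powr p \<le> h powr (2 - q) * (1 / (h\<^sup>2 + (t - t0)\<^sup>2))" .
    moreover have "cmod (f (Complex \<sigma> t)) powr p / (1 + t\<^sup>2) \<le> cmod (f (Complex \<sigma> t)) powr p / 1"
      by (intro divide_left_mono) (auto intro!: add_pos_nonneg)
    ultimately show ?thesis by simp
  qed
  define N where "N = h powr (1 - q) * (J / pi)"
  have N0: "0 \<le> N" using J by (simp add: N_def)
  have mean: "ennreal (1 / pi) * (\<integral>\<^sup>+ t. ennreal (cmod (f (Complex \<sigma> t)) powr p / (1 + t\<^sup>2)) \<partial>lborel) \<le> ennreal N"
    if \<sigma>: "\<theta> < \<sigma>" for \<sigma>
  proof -
    have "(\<integral>\<^sup>+ t. ennreal (cmod (f (Complex \<sigma> t)) powr p / (1 + t\<^sup>2)) \<partial>lborel)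
        \<le> (\<integral>\<^sup>+ t. ennreal (h powr (2 - q)) * ennreal (1 / (h\<^sup>2 + (t - t0)\<^sup>2)) \<partial>lborel)"
      using f_bd[OF \<sigma>] by (intro nn_integral_mono) (simp add: ennreal_mult''[symmetric] ennreal_leI)
    also have "\<dots> = ennreal (h powr (2 - q)) * (\<integral>\<^sup>+ t. ennreal (1 / (h\<^sup>2 + (t - t0)\<^sup>2)) \<partial>lborel)"
      by (rule nn_integral_cmult) measurable
    also have "\<dots> = ennreal (h powr (2 - q) * (1 / h * J))"
      using h J by (simp add: nn_integral_shifted_cauchy ennreal_mult''[symmetric])
    finally have "ennreal (1 / pi) * (\<integral>\<^sup>+ t. ennreal (cmod (f (Complex \<sigma> t)) powr p / (1 + t\<^sup>2)) \<partial>lborel)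
        \<le> ennreal (1 / pi) * ennreal (h powr (2 - q) * (1 / h * J))"
      by (rule mult_left_mono) simp
    also have "\<dots> = ennreal N"
    proof -
      have "h powr (2 - q) * (1 / h) = h powr (2 - q) * h powr (- 1)"
        using h by (simp add: powr_minus_divide)
      also have "\<dots> = h powr (1 - q)" by (simp only: powr_add[symmetric]) simp
      finally have eq: "h powr (2 - q) * (1 / h) = h powr (1 - q)" .
      have "1 / pi * (h powr (2 - q) * (1 / h * J)) = (h powr (2 - q) * (1 / h)) * (J / pi)"
        by simp
      then have "1 / pi * (h powr (2 - q) * (1 / h * J)) = N"
        unfolding eq N_def .
      then show ?thesis using J h by (subst ennreal_mult''[symmetric]) auto
    qed
    finally show ?thesis .
  qed
  have Hnorm: "Hpi_norm \<theta> p f \<le> ennreal (N powr (1 / p))"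
  proof -
    have "Hpi_norm \<theta> p f \<le> ennreal_powr (ennreal N) (1 / p)"
      unfolding Hpi_norm_def using mean p by (intro ennreal_powr_mono SUP_least) auto
    then show ?thesis using N0 by (simp add: ennreal_powr_ennreal)
  qed
  then have f_in: "f \<in> Hpi \<theta> p"
    using f_hol by (auto simp: Hpi_def intro: le_less_trans)
  let ?s = "Complex (\<theta> + h) t0"
  have ws: "w ?s = of_real (2 * h)" by (simp add: w_def complex_eq_iff)
  then have fs: "cmod (f ?s) powr p = (2 * h) powr (- q)"
    using f_norm[of ?s] h by simp
  have "{?s} \<in> sets \<nu>"
  proof (rule ccontr)
    assume "{?s} \<notin> sets \<nu>"
    then have "ennreal (B * h) \<le> 0"
      using h(2) emeasure_notin_sets[of "{?s}" \<nu>] by simp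
    moreover have "0 < B * h" using B h(1) by (rule mult_pos_pos)
    ultimately show False by auto
  qed
  then have "ennreal ((2 * h) powr (- q)) * emeasure \<nu> {?s} = (\<integral>\<^sup>+ s. ennreal ((2 * h) powr (- q)) * indicator {?s} s \<partial>\<nu>)"
    by (rule nn_integral_cmult_indicator[symmetric])
  also have "\<dots> \<le> (\<integral>\<^sup>+ s. ennreal_powr (ennreal (cmod (f s))) p \<partial>\<nu>)"
    by (intro nn_integral_mono) (auto simp: indicator_def ennreal_powr_ennreal fs)
  finally have "ennreal ((2 * h) powr (- q)) * ennreal (B * h) \<le> (\<integral>\<^sup>+ s. ennreal_powr (ennreal (cmod (f s))) p \<partial>\<nu>)"
    using h(2) by (meson mult_left_mono order_trans zero_le)
  then have "ennreal_powr (ennreal ((2 * h) powr (- q) * (B * h))) (1 / p) \<le> Lp_norm \<nu> p (\<lambda>s. ennreal (cmod (f s)))"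
    unfolding Lp_norm_def using p B h by (intro ennreal_powr_mono) (auto simp: ennreal_mult'')
  also have "\<dots> \<le> ennreal C * Hpi_norm \<theta> p f" by (rule C(2)[OF f_in])
  also have "\<dots> \<le> ennreal C * ennreal (N powr (1 / p))" by (intro mult_left_mono Hnorm) simp
  finally have "((2 * h) powr (- q) * (B * h)) powr (1 / p) \<le> C * N powr (1 / p)"
    using B h C by (simp add: ennreal_powr_ennreal ennreal_mult''[symmetric])
  then have "(((2 * h) powr (- q) * (B * h)) powr (1 / p)) powr p \<le> (C * N powr (1 / p)) powr p"
    using p by (intro powr_mono2) auto
  then have le: "(2 * h) powr (- q) * (B * h) \<le> C powr p * N"
    using p B h N0 by (simp add: powr_powr powr_mult)
  have "h powr (- q) * h = h powr (1 - q)"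
    using h powr_add[of h "- q" 1] by simp
  then have "(2 * h) powr (- q) * (B * h) = h powr (1 - q) * (2 powr (- q) * B)"
    by (simp add: powr_mult mult_ac)
  with le have "h powr (1 - q) * (2 powr (- q) * B) \<le> C powr p * N"
    by (simp only:)
  also have "\<dots> = h powr (1 - q) * (C powr p * (J / pi))"
    by (simp only: N_def mult.left_commute)
  finally have "h powr (1 - q) * (2 powr (- q) * B) \<le> h powr (1 - q) * (C powr p * (J / pi))" .
  then have "2 powr (- q) * B \<le> C powr p * (J / pi)"
    by (rule mult_left_le_imp_le) (use h in simp)
  then have "2 powr q * (2 powr (- q) * B) \<le> 2 powr q * (C powr p * (J / pi))"
    by (rule mult_left_mono) simp
  then have "B \<le> 2 powr q * (C powr p * (J / pi))"
    by (simp add: mult.assoc[symmetric] powr_add[symmetric])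
  then show False by (simp add: B_def)
qed

lemma emeasure_atom_ge: "ennreal ((1 / 2) ^ Suc k) \<le> emeasure sparse_measure {atom k}"
proof -
  have m: "{atom k} \<in> sets (restrict_space borel (halfplane 0))"
    using atom_in_halfplane[of k] by (auto simp: sets_restrict_space intro!: image_eqI[of _ _ "{atom k}"])
  have "ennreal ((1 / 2) ^ Suc k) = emeasure (measure_pmf (geometric_pmf (1 / 2))) {k}"
    by (simp add: emeasure_pmf_single)
  also have "\<dots> \<le> emeasure (measure_pmf (geometric_pmf (1 / 2))) (atom -` {atom k} \<inter> space (measure_pmf (geometric_pmf (1 / 2))))"
    by (rule emeasure_mono) auto
  also have "\<dots> = emeasure sparse_measure {atom k}"
    unfolding sparse_measure_def by (rule emeasure_distr[OF atom_measurable m, symmetric])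
  finally show ?thesis .
qed

lemma half_power_dominates_quarter_power:
  fixes B :: real
  shows "\<exists>k. (even k \<longleftrightarrow> b) \<and> B * (1 / 4) ^ k \<le> (1 / 2) ^ Suc k"
proof -
  obtain n where n: "2 * B < 2 ^ n"
    using real_arch_pow[of 2 "2 * B"] by auto
  define k where "k = (if b then 2 * n else 2 * n + 1)"
  have "(2 :: real) ^ n \<le> 2 ^ k"
    by (rule power_increasing) (auto simp: k_def)
  then have "B \<le> 2 ^ k / 2"
    using n by linarith
  then have "B * (1 / 4) ^ k \<le> (2 ^ k / 2) * (1 / 4) ^ k"
    by (rule mult_right_mono) simp
  also have "\<dots> = (1 / 2) ^ Suc k"
  proof -
    have "(4 :: real) ^ k = 2 ^ k * 2 ^ k" by (simp add: power_mult_distrib[symmetric])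
    then show ?thesis by (simp add: field_simps)
  qed
  finally show ?thesis by (intro exI[of _ k]) (auto simp: k_def)
qed

lemma heavy_atoms_sparse_measure: "heavy_atoms 0 sparse_measure"
  unfolding heavy_atoms_def
proof
  fix B :: real
  obtain k where k: "even k" "B * (1 / 4) ^ k \<le> (1 / 2) ^ Suc k"
    using half_power_dominates_quarter_power[of True B] by auto
  have "ennreal (B * (1 / 4) ^ k) \<le> emeasure sparse_measure {atom k}"
    by (rule order_trans[OF ennreal_leI[OF k(2)] emeasure_atom_ge])
  then show "\<exists>h>0. \<exists>t. ennreal (B * h) \<le> emeasure sparse_measure {Complex (0 + h) t}"
    using k(1) by (intro exI[of _ "(1 / 4) ^ k"] conjI exI[of _ "atom_im k"]) (auto simp: atom_def atom_re_def)
qed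

lemma heavy_atoms_sparse_measure_half: "heavy_atoms (1 / 2) (restrict_space sparse_measure (halfplane (1 / 2)))"
  unfolding heavy_atoms_def
proof
  fix B :: real
  obtain k where k: "odd k" "B * (1 / 4) ^ k \<le> (1 / 2) ^ Suc k"
    using half_power_dominates_quarter_power[of False B] by auto
  have half: "halfplane (1 / 2) \<inter> space sparse_measure \<in> sets sparse_measure"
    unfolding sets_sparse_measure sets_restrict_space
    by (auto simp: sparse_measure_def space_restrict_space intro!: image_eqI[of _ _ "halfplane (1 / 2)"] borel_open open_halfplane)
  have "atom k \<in> halfplane (1 / 2)"
    using k(1) by (simp add: halfplane_def atom_def atom_re_def)
  then have "emeasure (restrict_space sparse_measure (halfplane (1 / 2))) {atom k} = emeasure sparse_measure {atom k}"
    by (intro emeasure_restrict_space half) auto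
  then have "ennreal (B * (1 / 4) ^ k) \<le> emeasure (restrict_space sparse_measure (halfplane (1 / 2))) {atom k}"
    using order_trans[OF ennreal_leI[OF k(2)] emeasure_atom_ge] by simp
  then show "\<exists>h>0. \<exists>t. ennreal (B * h) \<le> emeasure (restrict_space sparse_measure (halfplane (1 / 2))) {Complex (1 / 2 + h) t}"
    using k(1) by (intro exI[of _ "(1 / 4) ^ k"] conjI exI[of _ "atom_im k"]) (auto simp: atom_def atom_re_def)
qed

lemma sets_sparse_measure_half:
  "sets (restrict_space sparse_measure (halfplane (1 / 2))) = sets (restrict_space borel (halfplane (1 / 2)))"
proof -
  have "sets (restrict_space sparse_measure (halfplane (1 / 2)))
      = sets (restrict_space (restrict_space borel (halfplane 0)) (halfplane (1 / 2)))"
    by (rule sets_restrict_space_cong[OF sets_sparse_measure])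
  also have "\<dots> = sets (restrict_space borel (halfplane 0 \<inter> halfplane (1 / 2)))"
    by (rule sets_restrict_restrict_space)
  also have "halfplane 0 \<inter> halfplane (1 / 2) = halfplane (1 / 2)"
    by (auto simp: halfplane_def)
  finally show ?thesis .
qed

theorem theorem3p3:
  shows "\<exists>\<mu> :: complex measure.
    prob_space \<mu> \<and> sets \<mu> = sets (restrict_space borel (halfplane 0)) \<and>
    (\<forall>p l :: real. 0 < p \<longrightarrow> 0 < l \<longrightarrow>
       area_op_bounded \<mu> l p (Hp p) \<and> area_op_bounded \<mu> l p (Hp0 p)) \<and>
    \<not> carleson_measure 0 \<mu> \<and>
    \<not> carleson_measure (1 / 2) (restrict_space \<mu> (halfplane (1 / 2))) \<and>
    (\<forall>p :: real. 0 < p \<longrightarrow>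
       \<not> Hpi_carleson_measure 0 p \<mu> \<and>
       \<not> Hpi_carleson_measure (1 / 2) p (restrict_space \<mu> (halfplane (1 / 2))))"
proof (intro exI[of _ sparse_measure] conjI allI impI)
  fix p l :: real assume "0 < p" "0 < l"
  then show "area_op_bounded sparse_measure l p (Hp p)" "area_op_bounded sparse_measure l p (Hp0 p)"
    by (auto intro!: area_op_bounded_sparse_measure simp: Hp0_def)
next
  fix p :: real assume "0 < p"
  then show "\<not> Hpi_carleson_measure 0 p sparse_measure"
    "\<not> Hpi_carleson_measure (1 / 2) p (restrict_space sparse_measure (halfplane (1 / 2)))"
    by (rule heavy_atoms_not_Hpi_carleson[OF _ heavy_atoms_sparse_measure]
        heavy_atoms_not_Hpi_carleson[OF _ heavy_atoms_sparse_measure_half])+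
next
  show "\<not> carleson_measure 0 sparse_measure"
    by (rule heavy_atoms_not_carleson[OF sets_sparse_measure heavy_atoms_sparse_measure])
  show "\<not> carleson_measure (1 / 2) (restrict_space sparse_measure (halfplane (1 / 2)))"
    by (rule heavy_atoms_not_carleson[OF sets_sparse_measure_half heavy_atoms_sparse_measure_half])
qed (rule prob_space_sparse_measure sets_sparse_measure)+

end
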